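(* Let $D$ be a connected diagram of a link with $N$ crossings such that the graph $G_{s_+}(D)$ has no loops (i.e. $D$ is $+$-adequate) and has an even $n$-cycle (a cycle of even length $n$) containing a singular edge (an edge that is not part of a 2-gon). Then $H_{N-4,\,N+2|s_+|-8}(D)$ has $\mathbb{Z}_2$ torsion.
   Context: Diagrams: $D$ is a diagram in the plane (disc) of an unoriented framed link, with ordered crossings. At each crossing there are two smoothings: the positive-marker smoothing ($A$-smoothing) joins the two local regions swept out when the overcrossing arc is rotated counterclockwise until it meets the undercrossing arc; the negative-marker smoothing joins the other two regions. A Kauffman state $s$ assigns $+1$ or $-1$ (a positive or negative marker) to each crossing; $D_s$ is the system of circles obtained by smoothing all crossings according to $s$, $|s|$ is the number of circles of $D_s$, and $\sigma(s)$ is the number of positive minus the number of negative markers. $s_+$ is the state with all markers positive. Khovanov homology: an enhanced state $S$ is a Kauffman state $s$ with a sign $+$ or $-$ on each circle of $D_s$; put $\sigma(S)=\sigma(s)$ and $\tau(S)=\#\{\text{positive circles}\}-\#\{\text{negative circles}\}$. $\mathcal{C}_{i,j}(D)$ is the free abelian group on enhanced states with $\sigma(S)=i$ and $\sigma(S)+2\tau(S)=j$. The differential $d_{i,j}:\mathcal{C}_{i,j}(D)\to\mathcal{C}_{i-2,j}(D)$ is $d(S)=\sum_{S'}(-1)^{t(S:S')}[S:S']S'$, the sum over enhanced states $S'$ generating $\mathcal C_{i-2,j}(D)$, where $[S:S']=1$ if the markers of $S$ and $S'$ differ at exactly one crossing $v$ and all circles not touching $v$ have the same sign in $S$ and $S'$,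 and $[S:S']=0$ otherwise; $t(S:S')$ is the number of negative markers of $S$ at crossings bigger than $v$ in the ordering. $H_{i,j}(D)=\ker(d_{i,j})/\mathrm{im}(d_{i+2,j})$. Graphs: $G_s(D)$ has a vertex for each circle of $D_s$ and an edge for each crossing of $D$, the edge joining the vertices of the circles of $D_s$ met at that crossing (multiple edges and loops allowed). An edge is singular if it is not part of a 2-gon, i.e. no other edge has the same pair of endpoints. "Has $\mathbb{Z}_2$ torsion" means: contains an element of order $2$. *)

theory Defs
  imports "HOL-Algebra.Free_Abelian_Groups" "HOL-Algebra.Multiplicative_Group"
begin

text \<open>
  A diagram is given by its planar diagram code, i.e. by a combinatorial map. The crossings are
  \<open>0, \<dots>, N - 1\<close>, ordered as natural numbers. The four arc ends (darts) at the crossing \<open>v\<close> are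
  \<open>(v,0), (v,1), (v,2), (v,3)\<close> in counterclockwise order; \<open>(v,0)\<close> and \<open>(v,2)\<close> belong to the
  undercrossing arc, \<open>(v,1)\<close> and \<open>(v,3)\<close> to the overcrossing arc. The involution \<open>opp\<close> sends an
  arc end to the other end of the same arc of the diagram. Link components without any crossing
  are not represented: a connected diagram with at least one crossing has none.
\<close>

record link_diagram =
  ncross :: nat
  opp :: "nat \<times> nat \<Rightarrow> nat \<times> nat"

definition darts :: "link_diagram \<Rightarrow> (nat \<times> nat) set" where
  "darts D = {..<ncross D} \<times> {..<4}"

definition rot :: "nat \<times> nat \<Rightarrow> nat \<times> nat" where
  "rot = (\<lambda>(v, p). (v, (p + 1) mod 4))"

text \<open>
  The orbits on \<open>A\<close> of the group generated by \<open>F\<close>. All uses below have \<open>A\<close> finite and \<open>F\<close>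
  consisting of permutations of \<open>A\<close>, so that the reflexive transitive closure is symmetric on \<open>A\<close>.
\<close>
definition orbits :: "'a set \<Rightarrow> ('a \<Rightarrow> 'a) set \<Rightarrow> 'a set set" where
  "orbits A F = A // {(x, f x) | x f. x \<in> A \<and> f \<in> F}\<^sup>*"

definition arcs :: "link_diagram \<Rightarrow> (nat \<times> nat) set set" where
  "arcs D = orbits (darts D) {opp D}"

text \<open>
  The dart \<open>x\<close> stands for the corner between \<open>x\<close> and \<open>rot x\<close>. Leaving the crossing along
  \<open>rot x\<close>, that corner lies on the right; so the next corner of the same region is the one
  that follows the dart \<open>opp D (rot x)\<close> counterclockwise.
\<close>
definition faces :: "link_diagram \<Rightarrow> (nat \<times> nat) set set" where
  "faces D = orbits (darts D) {opp D \<circ> rot}"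

definition diagram_components :: "link_diagram \<Rightarrow> (nat \<times> nat) set set" where
  "diagram_components D = orbits (darts D) {opp D, rot}"

text \<open>
  Planarity is Euler's formula. No connected component of a combinatorial map has Euler
  characteristic bigger than 2, so the formula says that each of them has genus 0.
\<close>
definition is_link_diagram :: "link_diagram \<Rightarrow> bool" where
  "is_link_diagram D \<longleftrightarrow>
     (\<forall>x \<in> darts D. opp D x \<in> darts D \<and> opp D x \<noteq> x \<and> opp D (opp D x) = x) \<and>
     int (ncross D) - int (card (arcs D)) + int (card (faces D))
       = 2 * int (card (diagram_components D))"

definition connected_diagram :: "link_diagram \<Rightarrow> bool" where
  "connected_diagram D \<longleftrightarrow> card (diagram_components D) = 1"

definition kauffman_states :: "link_diagram \<Rightarrow> (nat \<Rightarrow> int) set" where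
  "kauffman_states D = {..<ncross D} \<rightarrow>\<^sub>E {1, -1}"

text \<open>
  Rotated counterclockwise, the overcrossing arc sweeps out the corner between \<open>(v,1)\<close> and
  \<open>(v,2)\<close> and the corner between \<open>(v,3)\<close> and \<open>(v,0)\<close>. When these two are joined (positive marker),
  the two remaining strands connect \<open>(v,0)\<close> with \<open>(v,1)\<close> and \<open>(v,2)\<close> with \<open>(v,3)\<close>. For a negative
  marker the strands connect \<open>(v,1)\<close> with \<open>(v,2)\<close> and \<open>(v,3)\<close> with \<open>(v,0)\<close>.
\<close>
definition smoothing :: "(nat \<Rightarrow> int) \<Rightarrow> nat \<times> nat \<Rightarrow> nat \<times> nat" where
  "smoothing s = (\<lambda>(v, p).
     if s v = 1 then (v, if even p then p + 1 else p - 1)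
     else (v, if odd p then (p + 1) mod 4 else (p + 3) mod 4))"

text \<open>A circle of \<open>D\<^sub>s\<close> is represented by the set of the arc ends it runs through.\<close>
definition circles :: "link_diagram \<Rightarrow> (nat \<Rightarrow> int) \<Rightarrow> (nat \<times> nat) set set" where
  "circles D s = orbits (darts D) {opp D, smoothing s}"

definition touches :: "(nat \<times> nat) set \<Rightarrow> nat \<Rightarrow> bool" where
  "touches c v \<longleftrightarrow> (\<exists>p. (v, p) \<in> c)"

definition s_plus :: "link_diagram \<Rightarrow> nat \<Rightarrow> int" where
  "s_plus D = (\<lambda>v \<in> {..<ncross D}. 1)"

type_synonym enhanced_state = "(nat \<Rightarrow> int) \<times> ((nat \<times> nat) set \<Rightarrow> int)"

definition enhanced_states :: "link_diagram \<Rightarrow> enhanced_state set" where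
  "enhanced_states D = (SIGMA s : kauffman_states D. circles D s \<rightarrow>\<^sub>E {1, -1})"

definition \<sigma> :: "link_diagram \<Rightarrow> enhanced_state \<Rightarrow> int" where
  "\<sigma> D S = int (card {v. v < ncross D \<and> fst S v = 1}) - int (card {v. v < ncross D \<and> fst S v = -1})"

definition \<tau> :: "link_diagram \<Rightarrow> enhanced_state \<Rightarrow> int" where
  "\<tau> D S = int (card {c \<in> circles D (fst S). snd S c = 1})
         - int (card {c \<in> circles D (fst S). snd S c = -1})"

definition generators :: "link_diagram \<Rightarrow> int \<Rightarrow> int \<Rightarrow> enhanced_state set" where
  "generators D i j = {S \<in> enhanced_states D. \<sigma> D S = i \<and> \<sigma> D S + 2 * \<tau> D S = j}"

definition chain_group :: "link_diagram \<Rightarrow> int \<Rightarrow> int \<Rightarrow> (enhanced_state \<Rightarrow>\<^sub>0 int) monoid" where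
  "chain_group D i j = free_Abelian_group (generators D i j)"

definition differ_exactly_at :: "link_diagram \<Rightarrow> enhanced_state \<Rightarrow> enhanced_state \<Rightarrow> nat \<Rightarrow> bool" where
  "differ_exactly_at D S S' v \<longleftrightarrow>
     v < ncross D \<and> fst S v \<noteq> fst S' v \<and> (\<forall>w < ncross D. w \<noteq> v \<longrightarrow> fst S w = fst S' w)"

text \<open>
  The circles not touching the crossing at which the two states differ are the same sets of arc
  ends in both states.
\<close>
definition incidence :: "link_diagram \<Rightarrow> enhanced_state \<Rightarrow> enhanced_state \<Rightarrow> int" where
  "incidence D S S' =
     (if \<exists>v. differ_exactly_at D S S' v \<and>
             (\<forall>c \<in> circles D (fst S). \<not> touches c v \<longrightarrow> snd S c = snd S' c)
      then 1 else 0)"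

text \<open>Only relevant for states differing at exactly one crossing.\<close>
definition t_exponent :: "link_diagram \<Rightarrow> enhanced_state \<Rightarrow> enhanced_state \<Rightarrow> nat" where
  "t_exponent D S S' =
     card {w. (THE v. differ_exactly_at D S S' v) < w \<and> w < ncross D \<and> fst S w = -1}"

definition differential ::
    "link_diagram \<Rightarrow> int \<Rightarrow> int \<Rightarrow> (enhanced_state \<Rightarrow>\<^sub>0 int) \<Rightarrow> (enhanced_state \<Rightarrow>\<^sub>0 int)" where
  "differential D i j = frag_extend (\<lambda>S.
     \<Sum>S' \<in> generators D (i - 2) j.
       frag_cmul ((-1) ^ t_exponent D S S' * incidence D S S') (frag_of S'))"

definition cycle_group :: "link_diagram \<Rightarrow> int \<Rightarrow> int \<Rightarrow> (enhanced_state \<Rightarrow>\<^sub>0 int) monoid" where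
  "cycle_group D i j = (chain_group D i j)
     \<lparr>carrier := kernel (chain_group D i j) (chain_group D (i - 2) j) (differential D i j)\<rparr>"

definition boundaries :: "link_diagram \<Rightarrow> int \<Rightarrow> int \<Rightarrow> (enhanced_state \<Rightarrow>\<^sub>0 int) set" where
  "boundaries D i j = differential D (i + 2) j ` carrier (chain_group D (i + 2) j)"

definition khovanov_homology ::
    "link_diagram \<Rightarrow> int \<Rightarrow> int \<Rightarrow> (enhanced_state \<Rightarrow>\<^sub>0 int) set monoid" where
  "khovanov_homology D i j = cycle_group D i j Mod boundaries D i j"

definition has_Z2_torsion :: "('a, 'b) monoid_scheme \<Rightarrow> bool" where
  "has_Z2_torsion G \<longleftrightarrow> (\<exists>x \<in> carrier G. group.ord G x = 2)"

text \<open>Undirected multigraphs: the set \<open>ends G e\<close> has two elements, or just one if \<open>e\<close> is a loop.\<close>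
record ('v, 'e) multigraph =
  vertices :: "'v set"
  edges :: "'e set"
  ends :: "'e \<Rightarrow> 'v set"

definition is_loop :: "('v, 'e) multigraph \<Rightarrow> 'e \<Rightarrow> bool" where
  "is_loop G e \<longleftrightarrow> e \<in> edges G \<and> (\<exists>x. ends G e = {x})"

definition singular_edge :: "('v, 'e) multigraph \<Rightarrow> 'e \<Rightarrow> bool" where
  "singular_edge G e \<longleftrightarrow> e \<in> edges G \<and> (\<forall>f \<in> edges G. f \<noteq> e \<longrightarrow> ends G f \<noteq> ends G e)"

text \<open>
  The cycle \<open>xs ! 0, es ! 0, xs ! 1, es ! 1, \<dots>, es ! (n - 1), xs ! 0\<close>. Cycles of length 1 are
  loops, those of length 2 are pairs of parallel edges.
\<close>
definition is_cycle :: "('v, 'e) multigraph \<Rightarrow> nat \<Rightarrow> 'v list \<Rightarrow> 'e list \<Rightarrow> bool" where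
  "is_cycle G n xs es \<longleftrightarrow>
     n \<ge> 1 \<and> length xs = n \<and> length es = n \<and> distinct xs \<and> distinct es \<and>
     set xs \<subseteq> vertices G \<and> set es \<subseteq> edges G \<and>
     (\<forall>k < n. ends G (es ! k) = {xs ! k, xs ! (Suc k mod n)})"

definition state_graph ::
    "link_diagram \<Rightarrow> (nat \<Rightarrow> int) \<Rightarrow> ((nat \<times> nat) set, nat) multigraph" where
  "state_graph D s =
     \<lparr>vertices = circles D s, edges = {..<ncross D}, ends = (\<lambda>v. {c \<in> circles D s. touches c v})\<rparr>"

end

theory Submission
  imports Defs
begin

text \<open>
  Let \<open>e\<close> be the singular edge of the even cycle \<open>C\<close> in \<open>G = G\<^bsub>s+\<^esub>(D)\<close>, and let \<open>y\<close> be the sum of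
  all enhanced states whose only negative marker is at \<open>e\<close> and that have one negative circle.
  These circles are the vertices of \<open>G / e\<close>, which has no loops since \<open>e\<close> is singular, so that every
  edge is counted from both of its ends: \<open>d y = 2 x\<close>, where \<open>x\<close> is a signed sum over all
  pairs \<open>{e, w}\<close> of crossings. Let \<open>\<phi>\<close> count modulo 2 the states of a chain whose two negative
  markers both lie in \<open>C\<close>. A circle of the state with one negative marker, at \<open>v\<close> in \<open>C\<close>, meets an even number
  of the other edges of \<open>C\<close>, because contracting \<open>v\<close> turns \<open>C\<close> into a shorter cycle. Hence \<open>\<phi>\<close>
  vanishes on boundaries, while \<open>\<phi>(x)\<close> is the length of \<open>C\<close> minus 1, which is odd.
\<close>

section \<open>Elements of order two in quotients, and coefficients of formal sums\<close>

text \<open>The cosets of \<open>H\<close> by elements of \<open>Z\<close> form the image of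
  \<open>Z\<close> under the projection to \<open>G Mod H\<close>, which makes the quotient a group.
  In it the coset of \<open>x\<close> is nontrivial and has trivial square.\<close>

lemma has_Z2_torsion_Mod:
  assumes "comm_group G" "subgroup Z G" "subgroup H G"
    and x: "x \<in> Z" "x \<notin> H" "x \<otimes>\<^bsub>G\<^esub> x \<in> H"
  shows "has_Z2_torsion (G\<lparr>carrier := Z\<rparr> Mod H)"
proof -
  interpret G: comm_group G by fact
  interpret H: normal H G using assms(3) by (rule G.subgroup_imp_normal)
  let ?K = "G\<lparr>carrier := Z\<rparr> Mod H" and ?q = "\<lambda>a. H #>\<^bsub>G\<^esub> a"
  have ZG: "Z \<subseteq> carrier G" using assms(2) by (rule subgroup.subset)
  interpret q: group_hom G "G Mod H" ?q
    by (intro group_hom.intro group_hom_axioms.intro G.is_group H.factorgroup_is_group H.r_coset_hom_Mod)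
  have "subgroup (?q ` Z) (G Mod H)" using assms(2) by (rule q.subgroup_img_is_subgroup)
  then have "group ((G Mod H)\<lparr>carrier := ?q ` Z\<rparr>)"
    by (rule subgroup.subgroup_is_group) (rule H.factorgroup_is_group)
  also have "(G Mod H)\<lparr>carrier := ?q ` Z\<rparr> = ?K"
    by (auto simp: FactGroup_def RCOSETS_def r_coset_def set_mult_def fun_eq_iff)
  finally interpret K: group ?K .
  have mem: "?q x \<in> carrier ?K"
    using x(1) by (auto simp: FactGroup_def RCOSETS_def r_coset_def)
  have "?q x \<noteq> \<one>\<^bsub>?K\<^esub>"
    using x ZG G.coset_join1[of H x] assms(3) by (auto simp: FactGroup_def subgroup.subset)
  moreover have "?q x [^]\<^bsub>?K\<^esub> (2::nat) = \<one>\<^bsub>?K\<^esub>"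
  proof -
    have "?q x [^]\<^bsub>?K\<^esub> (2::nat) = ?q x \<otimes>\<^bsub>?K\<^esub> ?q x"
      by (simp only: numeral_2_eq_2 K.nat_pow_Suc K.nat_pow_0 K.l_one[OF mem])
    also have "\<dots> = ?q (x \<otimes>\<^bsub>G\<^esub> x)"
      using x(1) ZG H.rcos_sum[of x x] by (auto simp: FactGroup_def)
    also have "\<dots> = \<one>\<^bsub>?K\<^esub>"
      using x ZG assms(3) G.coset_join2[of "x \<otimes>\<^bsub>G\<^esub> x" H] by (auto simp: FactGroup_def)
    finally show ?thesis .
  qed
  ultimately have "K.ord (?q x) \<noteq> 1" "K.ord (?q x) dvd 2"
    using mem K.pow_eq_id K.ord_eq_1 by simp_all
  \<comment> \<open>\<open>ord\<close> is 0 for elements of infinite order; this value is excluded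
    because 0 does not divide 2.\<close>
  then have "K.ord (?q x) = 2"
    using dvd_imp_le[of "K.ord (?q x)" 2] by (cases "K.ord (?q x) = 0") auto
  with mem show ?thesis unfolding has_Z2_torsion_def by blast
qed

lemma keys_frag_combination:
  "Poly_Mapping.keys (\<Sum>T\<in>A. frag_cmul (f T) (frag_of T)) \<subseteq> A"
proof -
  have "(\<Sum>T\<in>A. frag_cmul (f T) (frag_of T)) \<in> carrier (free_Abelian_group A)"
    by (rule sum_closed_free_Abelian_group) (auto dest: subsetD[OF keys_cmul])
  then show ?thesis by simp
qed

lemma lookup_frag_combination:
  assumes "finite A"
  shows "Poly_Mapping.lookup (\<Sum>T\<in>A. frag_cmul (f T) (frag_of T)) U = (if U \<in> A then f U else 0)"
  using assms
  by (simp add: lookup_sum lookup_single when_def if_distrib [where f="\<lambda>x. _ * x"] cong: if_cong)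

subsection \<open>Circles of Kauffman states\<close>

text \<open>Removing an orbit \<open>{x, f x}\<close> takes away two elements and leaves a set on
  which \<open>f\<close> is again an involution without fixed points.\<close>

lemma even_card_involution:
  assumes "finite A" and "\<And>x. x \<in> A \<Longrightarrow> f x \<in> A \<and> f x \<noteq> x \<and> f (f x) = x"
  shows "even (card A)"
  using assms
proof (induction A rule: finite_psubset_induct)
  case (psubset A)
  show ?case
  proof (cases "A = {}")
    case False
    then obtain x where x: "x \<in> A" by blast
    let ?B = "A - {x, f x}"
    have "even (card ?B)"
    proof (rule psubset.IH)
      show "?B \<subset> A" using x by blast
      fix y assume y: "y \<in> ?B"
      then have "f y \<noteq> x" "f y \<noteq> f x"
        using psubset.prems[OF x] psubset.prems[of y] by auto
      then show "f y \<in> ?B \<and> f y \<noteq> y \<and> f (f y) = y"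
        using psubset.prems[of y] y by auto
    qed
    moreover have "card A = card ?B + 2"
      using psubset.prems[OF x] x psubset.hyps
      by (subst card_Diff_subset) (auto simp: card_insert_if dest: card_mono[of A "{x, f x}"])
    ultimately show ?thesis by simp
  qed simp
qed

text \<open>When \<open>opp\<close> is a fixed-point-free involution, these sets are the unions of
  circles. Arguments with closed sets replace arguments about paths in the reflexive transitive
  closure.\<close>

definition corner_closed :: "link_diagram \<Rightarrow> (nat \<Rightarrow> int) \<Rightarrow> (nat \<times> nat) set \<Rightarrow> bool" where
  "corner_closed D s X \<longleftrightarrow> X \<subseteq> darts D \<and> (\<forall>x\<in>X. opp D x \<in> X \<and> smoothing s x \<in> X)"

lemma smoothing_dart:
  assumes "x \<in> darts D"
  shows "smoothing s x \<in> darts D" "fst (smoothing s x) = fst x" "smoothing s x \<noteq> x"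
    "smoothing s (smoothing s x) = x"
proof -
  obtain v p where x: "x = (v, p)" "v < ncross D" "p = 0 \<or> p = 1 \<or> p = 2 \<or> p = 3"
    using assms by (cases x) (fastforce simp: darts_def)
  then show "smoothing s x \<in> darts D" "fst (smoothing s x) = fst x" "smoothing s x \<noteq> x"
    "smoothing s (smoothing s x) = x"
    by (auto simp: smoothing_def darts_def)
qed

lemma smoothing_cong: "s (fst x) = s' (fst x) \<Longrightarrow> smoothing s x = smoothing s' x"
  by (cases x) (simp add: smoothing_def)

definition circle_of :: "link_diagram \<Rightarrow> (nat \<Rightarrow> int) \<Rightarrow> nat \<times> nat \<Rightarrow> (nat \<times> nat) set" where
  "circle_of D s x = {(x, f x) | x f. x \<in> darts D \<and> f \<in> {opp D, smoothing s}}\<^sup>* `` {x}"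

lemma circles_eq: "circles D s = circle_of D s ` darts D"
  by (auto simp: circles_def orbits_def quotient_def circle_of_def)

locale pd_code =
  fixes D :: link_diagram
  assumes opp: "x \<in> darts D \<Longrightarrow> opp D x \<in> darts D \<and> opp D x \<noteq> x \<and> opp D (opp D x) = x"
begin

abbreviation "circ \<equiv> circles D"

lemma finite_darts: "finite (darts D)"
  by (simp add: darts_def)

lemma circle_of_least:
  assumes "corner_closed D s X" "x \<in> X"
  shows "circle_of D s x \<subseteq> X"
proof
  fix y assume "y \<in> circle_of D s x"
  then have "(x, y) \<in> {(x, f x) | x f. x \<in> darts D \<and> f \<in> {opp D, smoothing s}}\<^sup>*"
    by (simp add: circle_of_def)
  then show "y \<in> X"
    by induction (use assms in \<open>auto simp: corner_closed_def\<close>)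
qed

lemma closed_circle_of:
  assumes "x \<in> darts D"
  shows "corner_closed D s (circle_of D s x)" "x \<in> circle_of D s x"
proof -
  let ?R = "{(x, f x) | x f. x \<in> darts D \<and> f \<in> {opp D, smoothing s}}"
  have "corner_closed D s (darts D)"
    using opp smoothing_dart(1) by (auto simp: corner_closed_def)
  from circle_of_least[OF this assms] have sub: "circle_of D s x \<subseteq> darts D" .
  show "x \<in> circle_of D s x" by (simp add: circle_of_def)
  show "corner_closed D s (circle_of D s x)"
    unfolding corner_closed_def
  proof (intro conjI ballI sub)
    fix y assume y: "y \<in> circle_of D s x"
    with sub have "y \<in> darts D" by blast
    then have "(y, opp D y) \<in> ?R" "(y, smoothing s y) \<in> ?R" by blast+
    with y show "opp D y \<in> circle_of D s x" "smoothing s y \<in> circle_of D s x"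
      unfolding circle_of_def Image_singleton_iff by (blast intro: rtrancl_into_rtrancl)+
  qed
qed

text \<open>\<open>opp\<close> and the smoothing are involutions on the darts, so neither can map a
  dart outside \<open>Y\<close> into \<open>Y\<close>.\<close>

lemma closed_Diff:
  assumes "corner_closed D s X" "corner_closed D s Y"
  shows "corner_closed D s (X - Y)"
proof -
  have "opp D x \<notin> Y \<and> smoothing s x \<notin> Y" if "x \<in> X" "x \<notin> Y" for x
  proof -
    have "x \<in> darts D" using that assms(1) by (auto simp: corner_closed_def)
    then have "opp D (opp D x) = x" "smoothing s (smoothing s x) = x"
      using opp smoothing_dart(4) by auto
    with that(2) assms(2) show ?thesis unfolding corner_closed_def by metis
  qed
  with assms(1) show ?thesis by (auto simp: corner_closed_def)
qed

lemma circle_closed: "c \<in> circ s \<Longrightarrow> corner_closed D s c"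
  by (auto simp: circles_eq closed_circle_of)

lemma circle_subset: "c \<in> circ s \<Longrightarrow> c \<subseteq> darts D"
  using circle_closed by (auto simp: corner_closed_def)

lemma circle_nonempty: "c \<in> circ s \<Longrightarrow> c \<noteq> {}"
  using closed_circle_of(2)[of _ s] by (fastforce simp: circles_eq)

text \<open>The base point of \<open>c\<close> lies in \<open>X\<close> or in \<open>c - X\<close>.
  Both are closed and a circle is the least closed set around its base point, so \<open>X\<close>
  cannot split \<open>c\<close>.\<close>

lemma circle_minimal:
  assumes c: "c \<in> circ s" and X: "corner_closed D s X" and "X \<inter> c \<noteq> {}"
  shows "c \<subseteq> X"
proof (rule ccontr)
  assume "\<not> c \<subseteq> X"
  obtain x where x: "x \<in> darts D" "c = circle_of D s x" using c by (auto simp: circles_eq)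
  have cl: "corner_closed D s (c - X)" "corner_closed D s (c - (c - X))"
    using X circle_closed[OF c] by (auto intro: closed_Diff)
  show False
  proof (cases "x \<in> X")
    case True
    then show False using circle_of_least[OF X True] x \<open>\<not> c \<subseteq> X\<close> by simp
  next
    case False
    then have "x \<in> c - X" using x closed_circle_of(2) by auto
    from circle_of_least[OF cl(1) this] x \<open>X \<inter> c \<noteq> {}\<close> show False by auto
  qed
qed

lemma circles_disjoint: "c \<in> circ s \<Longrightarrow> c' \<in> circ s \<Longrightarrow> c \<inter> c' \<noteq> {} \<Longrightarrow> c = c'"
  using circle_minimal circle_closed by (metis inf_commute subset_antisym)

lemma circle_of_circle: "x \<in> darts D \<Longrightarrow> circle_of D s x \<in> circ s"
  by (simp add: circles_eq)

lemma Union_circles: "\<Union> (circ s) = darts D"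
  using circle_subset[of _ s] circle_of_circle[of _ s] closed_circle_of(2)[of _ s] by blast

lemma finite_circles: "finite (circ s)"
  using finite_darts by (simp add: circles_eq)

section \<open>How the circles change with the marker at one crossing\<close>

lemma closed_off_crossing:
  assumes "corner_closed D s c" "\<And>w. w < ncross D \<Longrightarrow> w \<noteq> v \<Longrightarrow> s w = s' w" "\<not> touches c v"
  shows "corner_closed D s' c"
proof -
  have "smoothing s' x = smoothing s x" if "x \<in> c" for x
  proof (rule smoothing_cong)
    have "x \<in> darts D" "fst x \<noteq> v"
      using that assms(1,3) by (auto simp: corner_closed_def touches_def) (metis prod.collapse)
    then show "s' (fst x) = s (fst x)" using assms(2)[of "fst x"] by (auto simp: darts_def)
  qed
  with assms(1) show ?thesis by (auto simp: corner_closed_def)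
qed

text \<open>The smoothings agree along a circle that avoids \<open>v\<close>, so it is closed for
  \<open>s'\<close> too. The circle of \<open>s'\<close> through one of its darts is therefore
  contained in it, avoids \<open>v\<close> as well, and the same argument backwards gives
  equality.\<close>

lemma circle_off_crossing:
  assumes c: "c \<in> circ s" and eq: "\<And>w. w < ncross D \<Longrightarrow> w \<noteq> v \<Longrightarrow> s w = s' w"
    and nt: "\<not> touches c v"
  shows "c \<in> circ s'"
proof -
  obtain x where x: "x \<in> c" using circle_nonempty[OF c] by blast
  then have "x \<in> darts D" using circle_subset[OF c] by blast
  define c' where "c' = circle_of D s' x"
  have c': "c' \<in> circ s'" "x \<in> c'"
    using \<open>x \<in> darts D\<close> by (auto simp: c'_def circle_of_circle closed_circle_of)
  have "c' \<subseteq> c"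
    using circle_minimal[OF c'(1)] closed_off_crossing[OF circle_closed[OF c] eq nt] c' x by blast
  moreover from this have "\<not> touches c' v" using nt by (auto simp: touches_def)
  then have "c \<subseteq> c'"
    using circle_minimal[OF c] closed_off_crossing[OF circle_closed[OF c'(1)], of v s] eq c' x
    by (metis disjoint_iff)
  ultimately show ?thesis using c' by auto
qed

lemma circles_off_crossing:
  assumes "\<And>w. w < ncross D \<Longrightarrow> w \<noteq> v \<Longrightarrow> s w = s' w"
  shows "{c \<in> circ s. \<not> touches c v} = {c \<in> circ s'. \<not> touches c v}"
  using circle_off_crossing[of _ s v s'] circle_off_crossing[of _ s' v s] assms by auto

text \<open>Either smoothing pairs each odd dart at \<open>v\<close> with an even one, so
  \<open>(v, 0)\<close> and \<open>(v, 2)\<close> represent the two strands at \<open>v\<close>. The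
  two circles may coincide.\<close>

lemma touching_circles:
  assumes "v < ncross D"
  shows "{c \<in> circ s. touches c v} = {circle_of D s (v, 0), circle_of D s (v, 2)}"
proof (intro equalityI subsetI)
  have d: "(v, 0) \<in> darts D" "(v, 2) \<in> darts D" using assms by (auto simp: darts_def)
  show "c \<in> {c \<in> circ s. touches c v}" if "c \<in> {circle_of D s (v, 0), circle_of D s (v, 2)}" for c
    using that d closed_circle_of(2)[of _ s] circle_of_circle[of _ s] by (fastforce simp: touches_def)
  fix c assume "c \<in> {c \<in> circ s. touches c v}"
  then obtain p where c: "c \<in> circ s" "(v, p) \<in> c" by (auto simp: touches_def)
  moreover from this have "p < 4" using circle_subset by (fastforce simp: darts_def)
  then have "p = 0 \<or> p = 1 \<or> p = 2 \<or> p = 3" by auto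
  moreover have "smoothing s (v, p) \<in> c"
    using c circle_closed by (auto simp: corner_closed_def)
  moreover have "smoothing s (v, 1) \<in> {(v, 0), (v, 2)}" "smoothing s (v, 3) \<in> {(v, 0), (v, 2)}"
    by (simp_all add: smoothing_def)
  ultimately have "(v, 0) \<in> c \<or> (v, 2) \<in> c"
    by (elim disjE) auto
  then show "c \<in> {circle_of D s (v, 0), circle_of D s (v, 2)}"
    using c(1) d circles_disjoint[of _ s] circle_of_circle[of _ s] closed_circle_of(2)[of _ s] by blast
qed

lemma touching_circles_card:
  assumes "v < ncross D"
  shows "card {c \<in> circ s. touches c v} \<in> {1, 2}"
  by (auto simp: touching_circles[OF assms] card_insert_if)

lemma card_circles_split:
  "card (circ s) = card {c \<in> circ s. touches c v} + card {c \<in> circ s. \<not> touches c v}"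
proof -
  have "circ s = {c \<in> circ s. touches c v} \<union> {c \<in> circ s. \<not> touches c v}" by auto
  then show ?thesis using finite_circles by (metis (no_types, lifting) card_Un_disjoint
      disjoint_iff finite_Un mem_Collect_eq)
qed

text \<open>Only the circles at \<open>v\<close> change, and each state has one or two of
  them.\<close>

lemma card_circles_le:
  assumes "v < ncross D" "\<And>w. w < ncross D \<Longrightarrow> w \<noteq> v \<Longrightarrow> s w = s' w"
  shows "card (circ s') \<le> card (circ s) + 1"
  using card_circles_split[of s v] card_circles_split[of s' v] circles_off_crossing[of v s s', OF assms(2)]
    touching_circles_card[OF assms(1), of s] touching_circles_card[OF assms(1), of s'] by auto

text \<open>
  If only one of the two strands at \<open>v\<close> belonged to \<open>K\<close>, the part of \<open>K\<close> on the circle through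
  \<open>(v, 0)\<close> would have an even number of arc ends by \<open>opp\<close> and an odd one by the smoothings.
\<close>
lemma circle_of_merge:
  assumes v: "v < ncross D" and s: "s v = 1" "s' v \<noteq> 1"
    and eq: "\<And>w. w < ncross D \<Longrightarrow> w \<noteq> v \<Longrightarrow> s w = s' w"
    and ne: "circle_of D s (v, 0) \<noteq> circle_of D s (v, 2)"
  shows "circle_of D s' (v, 0) = circle_of D s' (v, 2)"
proof (rule ccontr)
  assume ne': "circle_of D s' (v, 0) \<noteq> circle_of D s' (v, 2)"
  define C K where "C = circle_of D s (v, 0)" and "K = circle_of D s' (v, 0)"
  have d: "(v, 0) \<in> darts D" "(v, 2) \<in> darts D" using v by (auto simp: darts_def)
  have cl: "corner_closed D s C" "corner_closed D s' K" "(v, 0) \<in> C" "(v, 0) \<in> K"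
    using d closed_circle_of unfolding C_def K_def by simp_all
  have cl2: "(v, 2) \<notin> C" "(v, 2) \<notin> K"
    using d ne circles_disjoint[of _ s] circle_of_circle[of _ s] closed_circle_of(2)[of _ s] C_def
    by (blast, use d ne' circles_disjoint[of _ s'] circle_of_circle[of _ s']
      closed_circle_of(2)[of _ s'] K_def in blast)
  have "smoothing s' (v, 1) = (v, 2)" "smoothing s (v, 3) = (v, 2)"
    using s by (auto simp: smoothing_def)
  then have nm: "(v, 1) \<notin> K" "(v, 3) \<notin> C"
    using cl cl2 by (auto simp: corner_closed_def)
  \<comment> \<open>At \<open>v\<close>, \<open>K\<close> misses the darts 1 and 2 and
    \<open>C\<close> misses 2 and 3. So every common dart except \<open>(v, 0)\<close> lies away
    from \<open>v\<close>, where the two smoothings agree.\<close>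
  have only: "x = (v, 0)" if x: "x \<in> C \<inter> K" "fst x = v" for x
  proof -
    have "x \<in> darts D" using x cl by (auto simp: corner_closed_def)
    then obtain p where "x = (v, p)" "p = 0 \<or> p = 1 \<or> p = 2 \<or> p = 3"
      using x(2) by (cases x) (fastforce simp: darts_def)
    then show ?thesis using x cl cl2 nm by auto
  qed
  have sub: "C \<inter> K \<subseteq> darts D" using cl by (auto simp: corner_closed_def)
  then have fin: "finite (C \<inter> K)" using finite_darts by (rule finite_subset)
  have "even (card (C \<inter> K))"
    by (rule even_card_involution[OF fin, of "opp D"])
      (use cl opp in \<open>auto simp: corner_closed_def\<close>)
  moreover have "even (card (C \<inter> K - {(v, 0)}))"
  proof (rule even_card_involution[of _ "smoothing s"])
    fix x assume x: "x \<in> C \<inter> K - {(v, 0)}"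
    then have xv: "fst x \<noteq> v" using only[of x] by blast
    have xd: "x \<in> darts D" using x sub by blast
    have "smoothing s x = smoothing s' x"
      using eq xv xd by (intro smoothing_cong) (auto simp: darts_def)
    moreover have "smoothing s x \<noteq> (v, 0)" using xv smoothing_dart(2)[OF xd, of s] by auto
    ultimately show "smoothing s x \<in> C \<inter> K - {(v, 0)} \<and> smoothing s x \<noteq> x
        \<and> smoothing s (smoothing s x) = x"
      using x cl smoothing_dart[OF xd, of s] unfolding corner_closed_def by (metis DiffE DiffI IntE IntI singletonD)
  qed (use fin in simp)
  moreover have "card (C \<inter> K) = Suc (card (C \<inter> K - {(v, 0)}))"
    by (rule card.remove) (use fin cl in auto)
  ultimately show False by simp
qed

text \<open>The circles avoiding \<open>v\<close> are common to both states, and circles partition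
  the darts; so the circles at \<open>v\<close> cover the same darts before and after the change.
  Afterwards there is just one, by \<open>circle_of_merge\<close>.\<close>

lemma merge:
  assumes v: "v < ncross D" and s: "s v = 1" "s' v \<noteq> 1"
    and eq: "\<And>w. w < ncross D \<Longrightarrow> w \<noteq> v \<Longrightarrow> s w = s' w"
    and two: "card {c \<in> circ s. touches c v} = 2"
  shows "{c \<in> circ s'. touches c v} = {\<Union> {c \<in> circ s. touches c v}}"
    and "Suc (card (circ s')) = card (circ s)"
proof -
  have "circle_of D s (v, 0) \<noteq> circle_of D s (v, 2)"
    using two by (auto simp: touching_circles[OF v])
  from circle_of_merge[of v s s', OF v s eq this]
  obtain K where K: "{c \<in> circ s'. touches c v} = {K}"
    by (simp add: touching_circles[OF v])
  have nt: "{c \<in> circ s. \<not> touches c v} = {c \<in> circ s'. \<not> touches c v}"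
    by (rule circles_off_crossing) (rule eq)
  have part: "\<Union> {c \<in> circ t. touches c v} = darts D - \<Union> {c \<in> circ t. \<not> touches c v}" for t
    using circles_disjoint[of _ t] Union_circles[of t] by blast
  have "K = \<Union> {c \<in> circ s'. touches c v}" unfolding K by simp
  also have "\<dots> = \<Union> {c \<in> circ s. touches c v}" unfolding part nt ..
  finally show "{c \<in> circ s'. touches c v} = {\<Union> {c \<in> circ s. touches c v}}" using K by simp
  show "Suc (card (circ s')) = card (circ s)"
    using card_circles_split[of s v] card_circles_split[of s' v] nt two K by simp
qed

end

subsection \<open>Enhanced states and the differential\<close>

definition negs :: "link_diagram \<Rightarrow> (nat \<Rightarrow> int) \<Rightarrow> nat set" where
  "negs D s = {v. v < ncross D \<and> s v = -1}"

definition state :: "link_diagram \<Rightarrow> nat set \<Rightarrow> nat \<Rightarrow> int" where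
  "state D M = (\<lambda>v\<in>{..<ncross D}. if v \<in> M then -1 else 1)"

text \<open>The matrix entry of the differential from \<open>S\<close> to \<open>T\<close>.\<close>

definition coef :: "link_diagram \<Rightarrow> enhanced_state \<Rightarrow> enhanced_state \<Rightarrow> int" where
  "coef D S T = (-1) ^ t_exponent D S T * incidence D S T"

lemma negs_subset: "negs D s \<subseteq> {..<ncross D}"
  by (auto simp: negs_def)

lemma finite_negs: "finite (negs D s)"
  by (rule finite_subset[OF negs_subset]) simp

lemma kauffman_state_pm1: "s \<in> kauffman_states D \<Longrightarrow> v < ncross D \<Longrightarrow> s v = 1 \<or> s v = -1"
  unfolding kauffman_states_def by (drule PiE_mem[of _ _ _ v]) simp_all

lemma kauffman_state_value:
  "s \<in> kauffman_states D \<Longrightarrow> v < ncross D \<Longrightarrow> s v = (if v \<in> negs D s then -1 else 1)"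
  using kauffman_state_pm1[of s D v] by (auto simp: negs_def)

lemma kauffman_state_eq_state:
  assumes "s \<in> kauffman_states D"
  shows "s = state D (negs D s)"
proof
  fix v
  show "s v = state D (negs D s) v"
  proof (cases "v < ncross D")
    case True
    then show ?thesis unfolding kauffman_state_value[OF assms True] by (simp add: state_def)
  next
    case False
    then show ?thesis
      using PiE_arb[OF assms[unfolded kauffman_states_def], of v] by (simp add: state_def)
  qed
qed

lemma state_in_kauffman_states: "state D M \<in> kauffman_states D"
  by (auto simp: state_def kauffman_states_def)

lemma negs_state: "M \<subseteq> {..<ncross D} \<Longrightarrow> negs D (state D M) = M"
  by (auto simp: state_def negs_def)

lemma s_plus_eq_state: "s_plus D = state D {}"
  by (simp add: s_plus_def state_def)

lemma enhanced_state_fst: "S \<in> enhanced_states D \<Longrightarrow> fst S = state D (negs D (fst S))"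
  by (rule kauffman_state_eq_state) (auto simp: enhanced_states_def)

lemma \<sigma>_eq:
  assumes "S \<in> enhanced_states D"
  shows "\<sigma> D S = int (ncross D) - 2 * int (card (negs D (fst S)))"
proof -
  have s: "fst S \<in> kauffman_states D" using assms by (auto simp: enhanced_states_def)
  have "{v. v < ncross D \<and> fst S v = 1} = {..<ncross D} - negs D (fst S)"
    using kauffman_state_pm1[OF s] by (force simp: negs_def)
  moreover have "card ({..<ncross D} - negs D (fst S)) = ncross D - card (negs D (fst S))"
    using negs_subset finite_negs by (simp add: card_Diff_subset)
  moreover have "card (negs D (fst S)) \<le> ncross D"
    using card_mono[OF _ negs_subset[of D "fst S"]] by simp
  ultimately show ?thesis by (simp add: \<sigma>_def negs_def)
qed

lemma differ_exactly_at_iff: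
  assumes "S \<in> enhanced_states D" "T \<in> enhanced_states D"
  shows "differ_exactly_at D S T v \<longleftrightarrow> v < ncross D \<and> (v \<in> negs D (fst S) \<longleftrightarrow> v \<notin> negs D (fst T))
    \<and> negs D (fst S) - {v} = negs D (fst T) - {v}"
proof -
  have st: "fst S \<in> kauffman_states D" "fst T \<in> kauffman_states D"
    using assms by (auto simp: enhanced_states_def)
  let ?A = "negs D (fst S)" and ?B = "negs D (fst T)"
  have val: "fst S w = fst T w \<longleftrightarrow> (w \<in> ?A \<longleftrightarrow> w \<in> ?B)" if "w < ncross D" for w
    using kauffman_state_value[OF st(1) that] kauffman_state_value[OF st(2) that] by auto
  have "?A \<subseteq> {..<ncross D}" "?B \<subseteq> {..<ncross D}" by (rule negs_subset)+
  then have "?A - {v} = ?B - {v} \<longleftrightarrow> (\<forall>w<ncross D. w \<noteq> v \<longrightarrow> (w \<in> ?A \<longleftrightarrow> w \<in> ?B))"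
    by blast
  then show ?thesis
    unfolding differ_exactly_at_def by (simp only: val cong: conj_cong imp_cong) blast
qed

lemma coef_insert:
  assumes S: "S \<in> enhanced_states D" and T: "T \<in> enhanced_states D"
    and v: "negs D (fst T) = insert v (negs D (fst S))" "v \<notin> negs D (fst S)"
  shows "coef D S T = (-1) ^ card {w \<in> negs D (fst S). v < w} *
    of_bool (\<forall>c \<in> circles D (fst S). \<not> touches c v \<longrightarrow> snd S c = snd T c)"
proof -
  have "v < ncross D" using v negs_subset[of D "fst T"] by auto
  \<comment> \<open>Uniqueness of the crossing evaluates the definite description in
    \<open>t_exponent\<close>.\<close>
  then have d: "differ_exactly_at D S T u \<longleftrightarrow> u = v" for u
    using v(2) unfolding differ_exactly_at_iff[OF S T] v(1) by blast
  have "{w. v < w \<and> w < ncross D \<and> fst S w = -1} = {w \<in> negs D (fst S). v < w}"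
    by (auto simp: negs_def)
  then show ?thesis
    by (simp add: coef_def t_exponent_def incidence_def d)
qed

text \<open>\<open>incidence\<close> does not record in which direction the marker changes; the
  numbers of negative markers do.\<close>

lemma coef_nonzeroE:
  assumes "S \<in> enhanced_states D" "T \<in> enhanced_states D"
    and card: "card (negs D (fst T)) = Suc (card (negs D (fst S)))" and "coef D S T \<noteq> 0"
  obtains v where "negs D (fst T) = insert v (negs D (fst S))" "v \<notin> negs D (fst S)"
proof -
  obtain v where "differ_exactly_at D S T v"
    using assms(4) by (auto simp: coef_def incidence_def split: if_splits)
  then have v: "v \<in> negs D (fst S) \<longleftrightarrow> v \<notin> negs D (fst T)"
    "negs D (fst S) - {v} = negs D (fst T) - {v}"
    using differ_exactly_at_iff[OF assms(1,2)] by auto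
  have notin: "v \<notin> negs D (fst S)"
  proof
    assume "v \<in> negs D (fst S)"
    then have "negs D (fst T) \<subseteq> negs D (fst S)" using v by blast
    from card_mono[OF finite_negs this] card show False by simp
  qed
  then have "v \<in> negs D (fst T)" using v(1) by simp
  then have "negs D (fst T) = insert v (negs D (fst T) - {v})" by (simp add: insert_absorb)
  also have "\<dots> = insert v (negs D (fst S))" using v(2) notin by (metis Diff_empty Diff_insert0)
  finally show thesis using notin by (rule that)
qed

section \<open>The differential in coordinates, cycles and boundaries\<close>

text \<open>Allowing any finite superset \<open>A\<close> of the support makes the index set
  independent of \<open>z\<close>, so that sums over generators can be exchanged later.\<close>

lemma lookup_differential:
  assumes "finite A" "Poly_Mapping.keys z \<subseteq> A" "finite (generators D (i - 2) j)"
  shows "Poly_Mapping.lookup (differential D i j z) T =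
    (if T \<in> generators D (i - 2) j then \<Sum>S\<in>A. Poly_Mapping.lookup z S * coef D S T else 0)"
proof -
  have "Poly_Mapping.lookup (differential D i j z) T =
    (\<Sum>S\<in>Poly_Mapping.keys z. Poly_Mapping.lookup z S *
      (if T \<in> generators D (i - 2) j then coef D S T else 0))"
    unfolding differential_def frag_extend_def coef_def
    by (simp only: lookup_sum[of _ "Poly_Mapping.keys z"] lookup_frag_cmul
        lookup_frag_combination[OF assms(3)])
  also have "\<dots> = (\<Sum>S\<in>A. Poly_Mapping.lookup z S *
      (if T \<in> generators D (i - 2) j then coef D S T else 0))"
    using assms(1,2) by (intro sum.mono_neutral_left) (auto simp: in_keys_iff)
  finally show ?thesis by (auto intro!: sum.neutral)
qed

lemma keys_differential: "Poly_Mapping.keys (differential D i j z) \<subseteq> generators D (i - 2) j"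
proof -
  have "differential D i j z \<in> carrier (free_Abelian_group (generators D (i - 2) j))"
    unfolding differential_def frag_extend_def
    by (intro sum_closed_free_Abelian_group)
      (simp add: order_trans[OF keys_cmul keys_frag_combination])
  then show ?thesis by simp
qed

lemma differential_add: "differential D i j (y + z) = differential D i j y + differential D i j z"
  by (simp add: differential_def frag_extend_add)

lemma subgroup_boundaries: "subgroup (boundaries D i j) (chain_group D i j)"
proof -
  have "differential D (i + 2) j \<in> hom (chain_group D (i + 2) j) (chain_group D i j)"
    using keys_differential[of D "i + 2" j] by (auto simp: hom_def chain_group_def differential_add)
  then show ?thesis
    unfolding boundaries_def
    by (intro group_hom.img_is_subgroup group_hom.intro group_hom_axioms.intro) (auto simp: chain_group_def)
qed

lemma subgroup_cycles:
  "subgroup (kernel (chain_group D i j) (chain_group D (i - 2) j) (differential D i j)) (chain_group D i j)"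
proof -
  have "differential D i j \<in> hom (chain_group D i j) (chain_group D (i - 2) j)"
    using keys_differential[of D i j] by (auto simp: hom_def chain_group_def differential_add)
  then show ?thesis
    by (intro group_hom.subgroup_kernel group_hom.intro group_hom_axioms.intro) (auto simp: chain_group_def)
qed

text \<open>
  The quotient makes sense without \<open>d \<circ> d = 0\<close>: it is the image of the cycles in the cokernel of
  the incoming differential.
\<close>
lemma khovanov_homology_has_Z2_torsion:
  assumes "Poly_Mapping.keys x \<subseteq> generators D i j" "differential D i j x = 0"
    and "x \<notin> boundaries D i j" "x + x \<in> boundaries D i j"
  shows "has_Z2_torsion (khovanov_homology D i j)"
  unfolding khovanov_homology_def cycle_group_def
  by (rule has_Z2_torsion_Mod[where x = x])
    (use assms subgroup_boundaries subgroup_cycles in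
      \<open>auto simp: chain_group_def abelian_free_Abelian_group kernel_def\<close>)

context pd_code
begin

lemma \<tau>_eq:
  assumes "S \<in> enhanced_states D"
  shows "\<tau> D S = int (card (circ (fst S))) - 2 * int (card {c \<in> circ (fst S). snd S c = -1})"
proof -
  have "{c \<in> circ (fst S). snd S c = 1} = circ (fst S) - {c \<in> circ (fst S). snd S c = -1}"
    using assms by (auto simp: enhanced_states_def)
  moreover have "card {c \<in> circ (fst S). snd S c = -1} \<le> card (circ (fst S))"
    by (intro card_mono finite_circles) auto
  ultimately show ?thesis
    using finite_circles by (simp add: \<tau>_def card_Diff_subset)
qed

lemma finite_generators: "finite (generators D i j)"
proof -
  have "finite (enhanced_states D)"
    unfolding enhanced_states_def kauffman_states_def
    using finite_circles by (intro finite_SigmaI finite_PiE) simp_all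
  then show ?thesis by (rule rev_finite_subset) (auto simp: generators_def)
qed

end

lemma state_value: "v < ncross D \<Longrightarrow> state D M v = (if v \<in> M then -1 else 1)"
  by (simp add: state_def)

section \<open>Enhanced states with at most one negative circle, and the grading\<close>

definition all_plus :: "link_diagram \<Rightarrow> nat set \<Rightarrow> enhanced_state" where
  "all_plus D M = (state D M, \<lambda>c\<in>circles D (state D M). 1)"

definition one_minus :: "link_diagram \<Rightarrow> nat \<Rightarrow> (nat \<times> nat) set \<Rightarrow> enhanced_state" where
  "one_minus D v c = (state D {v}, \<lambda>c'\<in>circles D (state D {v}). if c' = c then -1 else 1)"

definition minus_circles :: "link_diagram \<Rightarrow> enhanced_state \<Rightarrow> (nat \<times> nat) set set" where
  "minus_circles D S = {c \<in> circles D (fst S). snd S c = -1}"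

lemma enhanced_state_sign:
  "S \<in> enhanced_states D \<Longrightarrow> c \<in> circles D (fst S) \<Longrightarrow> snd S c = (if c \<in> minus_circles D S then -1 else 1)"
  unfolding enhanced_states_def minus_circles_def by (cases S) (auto dest: PiE_mem[of _ _ _ c])

text \<open>The sign functions take only the values 1 and -1 on circles and are extensional, so the
  negative circles determine them everywhere.\<close>

lemma enhanced_state_ext:
  assumes S: "S \<in> enhanced_states D" and T: "T \<in> enhanced_states D"
    and fst: "fst S = fst T" and minus: "minus_circles D S = minus_circles D T"
  shows "S = T"
proof -
  have "snd S c = snd T c" for c
  proof (cases "c \<in> circles D (fst S)")
    case True
    then show ?thesis
      using enhanced_state_sign[OF S, of c] enhanced_state_sign[OF T, of c] fst minus by simp
  next
    case False
    have "snd S \<in> extensional (circles D (fst S))" "snd T \<in> extensional (circles D (fst T))"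
      using S T by (auto simp: enhanced_states_def PiE_def)
    with False fst show ?thesis by (metis extensional_arb)
  qed
  with fst show ?thesis by (metis ext prod.expand)
qed

lemma all_plus_enhanced: "all_plus D M \<in> enhanced_states D"
  by (auto simp: all_plus_def enhanced_states_def state_in_kauffman_states)

lemma minus_circles_all_plus: "minus_circles D (all_plus D M) = {}"
  by (auto simp: all_plus_def minus_circles_def)

lemma one_minus_enhanced: "one_minus D v c \<in> enhanced_states D"
  by (auto simp: one_minus_def enhanced_states_def state_in_kauffman_states)

lemma minus_circles_one_minus:
  "c \<in> circles D (state D {v}) \<Longrightarrow> minus_circles D (one_minus D v c) = {c}"
  by (auto simp: one_minus_def minus_circles_def)

lemma fst_all_plus [simp]: "fst (all_plus D M) = state D M"
  by (simp add: all_plus_def)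

lemma fst_one_minus [simp]: "fst (one_minus D v c) = state D {v}"
  by (simp add: one_minus_def)

context pd_code
begin

text \<open>
  In this quantum grading a state with only positive markers has exactly two negative circles;
  \<open>k\<close> is the number of negative markers.
\<close>
definition gen :: "nat \<Rightarrow> enhanced_state set" where
  "gen k = generators D (int (ncross D) - 2 * int k)
     (int (ncross D) + 2 * int (card (circ (state D {}))) - 8)"

text \<open>With \<open>m\<close> negative circles the grading equation is
  \<open>N - 2k + 2(|s| - 2m) = N + 2|s+| - 8\<close>. It is halved and rearranged so that no
  subtraction remains.\<close>

lemma gen_iff:
  "S \<in> gen k \<longleftrightarrow> S \<in> enhanced_states D \<and> card (negs D (fst S)) = k \<and>
     int (card (circ (fst S))) + 4 = int (card (circ (state D {}))) + int k
       + 2 * int (card (minus_circles D S))"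
  unfolding gen_def generators_def minus_circles_def by (auto simp: \<sigma>_eq \<tau>_eq)

lemma finite_gen: "finite (gen k)"
  by (simp add: gen_def finite_generators)

lemma gen_enhanced: "S \<in> gen k \<Longrightarrow> S \<in> enhanced_states D"
  by (simp add: gen_iff)

lemma gen_nonzeroE:
  assumes "S \<in> gen k" "T \<in> gen (Suc k)" "coef D S T \<noteq> 0"
  obtains v where "negs D (fst T) = insert v (negs D (fst S))" "v \<notin> negs D (fst S)"
  using assms by (auto simp: gen_iff elim: coef_nonzeroE)

definition ends_of :: "nat \<Rightarrow> (nat \<times> nat) set set" where
  "ends_of v = {c \<in> circ (state D {}). touches c v}"

end

section \<open>Contracting one or two edges of a loopless state graph\<close>

locale loopless_diagram = pd_code +
  assumes loopless: "v < ncross D \<Longrightarrow> card (ends_of v) = 2"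
begin

text \<open>Making the marker at \<open>v\<close> negative contracts the edge \<open>v\<close>: its
  two ends, distinct by looplessness, merge and nothing else changes.\<close>

lemma circles_one_marker:
  assumes v: "v < ncross D"
  shows "{c \<in> circ (state D {v}). touches c v} = {\<Union> (ends_of v)}"
    and "Suc (card (circ (state D {v}))) = card (circ (state D {}))"
    and "{c \<in> circ (state D {v}). \<not> touches c v} = {c \<in> circ (state D {}). \<not> touches c v}"
  using merge[of v "state D {}" "state D {v}"] circles_off_crossing[of v "state D {v}" "state D {}"]
    loopless[OF v] v by (auto simp: ends_of_def state_value)

text \<open>If \<open>w\<close> became a loop when \<open>v\<close> is contracted, its circle would
  contain both ends of \<open>w\<close> and so be no old circle. It would then be the merged circle,
  whose only old parts are the ends of \<open>v\<close>, and \<open>w\<close> would be parallel to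
  \<open>v\<close>.\<close>

lemma card_touching_one_marker:
  assumes v: "v < ncross D" and w: "w < ncross D" and ne: "ends_of v \<noteq> ends_of w"
  shows "card {c \<in> circ (state D {v}). touches c w} = 2"
proof (rule ccontr)
  assume "card {c \<in> circ (state D {v}). touches c w} \<noteq> 2"
  then have "card {c \<in> circ (state D {v}). touches c w} = 1"
    using touching_circles_card[OF w, of "state D {v}"] by simp
  then obtain K where K: "{c \<in> circ (state D {v}). touches c w} = {K}"
    by (auto simp: card_1_singleton_iff)
  have sub: "A \<subseteq> K" if A: "A \<in> ends_of w" for A
  proof -
    have "\<exists>c \<in> circ (state D {v}). A \<subseteq> c"
    proof (cases "touches A v")
      case True
      then have "A \<in> ends_of v" using A by (simp add: ends_of_def)
      then show ?thesis using circles_one_marker(1)[OF v] by blast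
    next
      case False
      then show ?thesis using A circles_one_marker(3)[OF v] by (auto simp: ends_of_def)
    qed
    then obtain c where c: "c \<in> circ (state D {v})" "A \<subseteq> c" by blast
    then have "touches c w" using A by (auto simp: ends_of_def touches_def)
    with c K show ?thesis by blast
  qed
  have circ0: "A \<in> circ (state D {})" "A \<noteq> {}" if "A \<in> ends_of u" for A u
    using that circle_nonempty by (auto simp: ends_of_def)
  have "K \<notin> circ (state D {})"
  proof
    assume K0: "K \<in> circ (state D {})"
    have "A = K" if "A \<in> ends_of w" for A
      using circles_disjoint[OF circ0(1)[OF that] K0] sub[OF that] circ0(2)[OF that] by blast
    then have "ends_of w \<subseteq> {K}" by blast
    from card_mono[OF _ this] loopless[OF w] show False by simp
  qed
  moreover have "K \<in> circ (state D {v})" using K by blast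
  ultimately have "K \<in> {c \<in> circ (state D {v}). touches c v}"
    using circles_one_marker(3)[OF v] by blast
  then have K_eq: "K = \<Union> (ends_of v)" unfolding circles_one_marker(1)[OF v] by simp
  have "ends_of w \<subseteq> ends_of v"
  proof
    fix A assume A: "A \<in> ends_of w"
    from circ0(2)[OF A] obtain x where x: "x \<in> A" by blast
    with sub[OF A] K_eq obtain B where B: "B \<in> ends_of v" "x \<in> B" by blast
    then have "A = B" using circles_disjoint[OF circ0(1)[OF A] circ0(1)[OF B(1)]] x by blast
    with B show "A \<in> ends_of v" by simp
  qed
  moreover have "finite (ends_of v)" using finite_circles by (simp add: ends_of_def)
  ultimately show False using ne loopless[OF v] loopless[OF w] by (metis card_subset_eq)
qed

lemma card_circles_two_markers:
  assumes v: "v < ncross D" and w: "w < ncross D" and ne: "ends_of v \<noteq> ends_of w"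
  shows "card (circ (state D {v, w})) + 2 = card (circ (state D {}))"
proof -
  have "v \<noteq> w" using ne by blast
  then have "Suc (card (circ (state D {v, w}))) = card (circ (state D {v}))"
    using merge(2)[of w "state D {v}" "state D {v, w}"] card_touching_one_marker[OF assms] w
    by (auto simp: state_value)
  with circles_one_marker(2)[OF v] show ?thesis by simp
qed

lemma all_plus_in_gen:
  assumes "v < ncross D" "w < ncross D" "ends_of v \<noteq> ends_of w"
  shows "all_plus D {v, w} \<in> gen 2"
  using assms card_circles_two_markers[OF assms]
  by (auto simp: gen_iff all_plus_enhanced minus_circles_all_plus negs_state card_insert_if)

text \<open>Contracting two nonparallel edges loses two circles, and the grading then leaves no
  negative circle.\<close>

lemma gen_2_eq_all_plus:
  assumes T: "T \<in> gen 2" and M: "negs D (fst T) = {v, w}" and ne: "ends_of v \<noteq> ends_of w"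
  shows "T = all_plus D {v, w}"
proof (rule enhanced_state_ext)
  have vw: "v < ncross D" "w < ncross D" using M negs_subset[of D "fst T"] by auto
  show T': "T \<in> enhanced_states D" using T by (rule gen_enhanced)
  show fst: "fst T = fst (all_plus D {v, w})" using enhanced_state_fst[OF T'] M by simp
  have "card (minus_circles D T) = 0"
    using T card_circles_two_markers[OF vw ne] fst by (simp add: gen_iff)
  then show "minus_circles D T = minus_circles D (all_plus D {v, w})"
    using finite_circles by (simp add: minus_circles_all_plus) (simp add: minus_circles_def)
qed (rule all_plus_enhanced)

lemma one_minus_in_gen:
  assumes "v < ncross D" "c \<in> circ (state D {v})"
  shows "one_minus D v c \<in> gen 1"
  using assms circles_one_marker(2)[OF assms(1)]
  by (auto simp: gen_iff one_minus_enhanced minus_circles_one_minus negs_state)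

text \<open>One contraction loses one circle, and the grading then demands exactly one negative
  circle.\<close>

lemma gen_1_eq_one_minus:
  assumes S: "S \<in> gen 1" and M: "negs D (fst S) = {v}"
  obtains c where "c \<in> circ (state D {v})" "S = one_minus D v c"
proof -
  have v: "v < ncross D" using M negs_subset[of D "fst S"] by auto
  have S': "S \<in> enhanced_states D" using S by (rule gen_enhanced)
  have fst: "fst S = state D {v}" using enhanced_state_fst[OF S'] M by simp
  have "card (minus_circles D S) = 1"
    using S circles_one_marker(2)[OF v] fst by (simp add: gen_iff)
  then obtain c where c: "minus_circles D S = {c}" by (auto simp: card_1_singleton_iff)
  then have "c \<in> circ (state D {v})" using fst by (auto simp: minus_circles_def)
  moreover from this have "S = one_minus D v c"
    using c fst by (intro enhanced_state_ext[OF S' one_minus_enhanced]) (simp_all add: minus_circles_one_minus)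
  ultimately show thesis by (rule that)
qed

text \<open>The target has only positive circles, so the negative circle \<open>c\<close> must be
  among those that change, namely those at \<open>w\<close>. The sign counts the only negative
  marker \<open>v\<close> of the source if it is above \<open>w\<close>.\<close>

lemma coef_one_minus:
  assumes v: "v < ncross D" and w: "w < ncross D" and ne: "ends_of v \<noteq> ends_of w"
    and c: "c \<in> circ (state D {v})"
  shows "coef D (one_minus D v c) (all_plus D {v, w}) = (if w < v then -1 else 1) * of_bool (touches c w)"
proof -
  have vw: "v \<noteq> w" using ne by blast
  have "coef D (one_minus D v c) (all_plus D {v, w}) = (-1) ^ card {u \<in> {v}. w < u} *
    of_bool (\<forall>c' \<in> circ (state D {v}). \<not> touches c' w \<longrightarrow>
      snd (one_minus D v c) c' = snd (all_plus D {v, w}) c')"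
    using coef_insert[OF one_minus_enhanced[of D v c] all_plus_enhanced[of D "{v, w}"], of w] v w vw
    by (simp add: negs_state insert_commute)
  also have "{u \<in> {v}. w < u} = (if w < v then {v} else {})" by auto
  also have "(\<forall>c' \<in> circ (state D {v}). \<not> touches c' w \<longrightarrow>
      snd (one_minus D v c) c' = snd (all_plus D {v, w}) c') \<longleftrightarrow> touches c w"
  proof -
    have "snd (all_plus D {v, w}) c' = 1" if "c' \<in> circ (state D {v})" "\<not> touches c' w" for c'
    proof -
      \<comment> \<open>\<open>all_plus\<close> is \<open>undefined\<close> off the circles of its
        own state, so \<open>c'\<close> has to be recognised as one of them.\<close>
      have "c' \<in> circ (state D {v, w})"
        by (rule circle_off_crossing[OF that(1) _ that(2)]) (auto simp: state_value)
      then show ?thesis by (simp add: all_plus_def)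
    qed
    moreover have "snd (one_minus D v c) c' = (if c' = c then -1 else 1)"
      if "c' \<in> circ (state D {v})" for c'
      using that by (simp add: one_minus_def)
    ultimately show ?thesis using c by force
  qed
  finally show ?thesis by simp
qed

end

subsection \<open>The torsion class\<close>

lemma card_pair_filter:
  "a \<noteq> b \<Longrightarrow> card {z \<in> {a, b}. P z} = of_bool (P a) + of_bool (P b)"
  by (auto simp: Collect_conv_if conj_disj_distribR Collect_disj_eq)

text \<open>If the negative markers of \<open>T\<close> are at \<open>e\<close> and
  \<open>w\<close>, this is the sign with which the differential changes the marker at
  \<open>w\<close> in a state whose only negative marker is at \<open>e\<close>.\<close>

definition sign :: "link_diagram \<Rightarrow> nat \<Rightarrow> enhanced_state \<Rightarrow> int" where
  "sign D e T = (-1) ^ card {w \<in> negs D (fst T). w < e}"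

context loopless_diagram
begin

definition through :: "nat \<Rightarrow> enhanced_state set" where
  "through e = {T \<in> gen 2. e \<in> negs D (fst T)}"

definition torsion_chain :: "nat \<Rightarrow> enhanced_state \<Rightarrow>\<^sub>0 int" where
  "torsion_chain e = (\<Sum>T\<in>through e. frag_cmul (sign D e T) (frag_of T))"

lemma finite_through: "finite (through e)"
  using finite_gen by (simp add: through_def)

context
  fixes e
  assumes e: "e < ncross D"
    and singular: "\<And>f. f < ncross D \<Longrightarrow> f \<noteq> e \<Longrightarrow> ends_of e \<noteq> ends_of f"
begin

text \<open>No edge is parallel to \<open>e\<close>, so each pair \<open>{e, w}\<close> carries
  exactly one state of this grading, the one with positive circles only.\<close>

lemma through_iff: "T \<in> through e \<longleftrightarrow> (\<exists>w<ncross D. w \<noteq> e \<and> T = all_plus D {e, w})"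
proof
  assume T: "T \<in> through e"
  then have "card (negs D (fst T)) = 2" "e \<in> negs D (fst T)"
    by (auto simp: through_def gen_iff)
  then obtain w where w: "negs D (fst T) = {e, w}" "w \<noteq> e"
    by (auto simp: card_2_iff doubleton_eq_iff)
  moreover from this have "w < ncross D" using negs_subset[of D "fst T"] by auto
  ultimately show "\<exists>w<ncross D. w \<noteq> e \<and> T = all_plus D {e, w}"
    using gen_2_eq_all_plus[of T e w] singular[of w] T by (auto simp: through_def)
next
  assume "\<exists>w<ncross D. w \<noteq> e \<and> T = all_plus D {e, w}"
  then show "T \<in> through e"
    using all_plus_in_gen[OF e] singular e by (auto simp: through_def negs_state)
qed

text \<open>
  A target of a state with only positive circles has one more circle and no negative one. So the
  two ways of reaching it from \<open>torsion_chain\<close> contribute opposite signs.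
\<close>
lemma torsion_chain_cycle_coef:
  assumes T: "T \<in> gen 3"
  shows "(\<Sum>S\<in>through e. sign D e S * coef D S T) = 0"
proof (cases "e \<in> negs D (fst T)")
  case False
  have "coef D S T = 0" if "S \<in> through e" for S
  proof (rule ccontr)
    assume "coef D S T \<noteq> 0"
    moreover have "S \<in> gen 2" "e \<in> negs D (fst S)" using that by (auto simp: through_def)
    ultimately show False using gen_nonzeroE[of S 2 T] T False by (auto simp: eval_nat_numeral)
  qed
  then show ?thesis by (intro sum.neutral) simp
next
  case True
  have T': "T \<in> enhanced_states D" using T by (rule gen_enhanced)
  have "card (negs D (fst T) - {e}) = 2" using T True finite_negs by (simp add: gen_iff)
  then obtain w u where "negs D (fst T) - {e} = {w, u}" and wu: "w \<noteq> u"
    by (auto simp: card_2_iff)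
  with True have M: "negs D (fst T) = {e, w, u}" and ew: "w \<noteq> e" "u \<noteq> e" by auto
  have lt: "w < ncross D" "u < ncross D" using M negs_subset[of D "fst T"] by auto
  have fstT: "fst T = state D {e, w, u}" using enhanced_state_fst[OF T'] M by simp
  \<comment> \<open>There are at most \<open>(|s+| - 2) + 1\<close> circles, while the grading
    demands \<open>|s+| - 1 + 2m\<close> of them if \<open>m\<close> are negative; hence
    \<open>m = 0\<close>.\<close>
  have "card (circ (fst T)) \<le> card (circ (state D {e, w})) + 1"
    by (rule card_circles_le[OF lt(2)]) (auto simp: fstT state_value)
  with card_circles_two_markers[OF e lt(1)] singular[OF lt(1)] ew T
  have "card (minus_circles D T) = 0" by (auto simp: gen_iff)
  then have "minus_circles D T = {}" using finite_circles by (simp add: minus_circles_def)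
  then have plus: "snd T c = 1" if "c \<in> circ (fst T)" for c
    using enhanced_state_sign[OF T' that] by simp
  \<comment> \<open>The first summand of the exponent comes from \<open>sign\<close>, the other two
    count the negative markers above \<open>b\<close>. Exchanging \<open>a\<close> and
    \<open>b\<close> affects only \<open>b < a\<close>, which flips the sign.\<close>
  have coef: "sign D e (all_plus D {e, a}) * coef D (all_plus D {e, a}) T =
      (-1) ^ (of_bool (a < e) + of_bool (b < e) + of_bool (b < a))"
    if ab: "a \<noteq> b" "{a, b} = {w, u}" for a b
  proof -
    have ab': "a \<noteq> e" "b \<noteq> e" "a < ncross D" "b < ncross D" "negs D (fst T) = insert b {e, a}"
      using ab ew lt M by (auto simp: doubleton_eq_iff)
    have neg: "negs D (fst (all_plus D {e, a})) = {e, a}" using e ab' by (simp add: negs_state)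
    have fst_ab: "fst T = state D (insert b {e, a})"
      using enhanced_state_fst[OF T'] unfolding ab'(5) .
    have "snd (all_plus D {e, a}) c = snd T c" if c: "c \<in> circ (state D {e, a})" "\<not> touches c b" for c
    proof -
      have "c \<in> circ (fst T)"
        using ab' by (intro circle_off_crossing[OF c(1) _ c(2)])
          (simp add: fst_ab state_value)
      with plus c show ?thesis by (simp add: all_plus_def)
    qed
    then have "coef D (all_plus D {e, a}) T = (-1) ^ card {z \<in> {e, a}. b < z}"
      using coef_insert[OF all_plus_enhanced[of D "{e, a}"] T', of b] ab ab' neg by simp
    moreover have "sign D e (all_plus D {e, a}) = (-1) ^ card {z \<in> {e, a}. z < e}"
      unfolding sign_def neg ..
    ultimately show ?thesis
      by (simp only: card_pair_filter[OF not_sym[OF ab'(1)]]) (simp add: power_add)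
  qed
  have ne: "all_plus D {e, w} \<noteq> all_plus D {e, u}"
  proof
    assume "all_plus D {e, w} = all_plus D {e, u}"
    then have "negs D (state D {e, w}) = negs D (state D {e, u})" by (metis fst_all_plus)
    then show False using e lt ew wu by (auto simp: negs_state doubleton_eq_iff)
  qed
  have "(\<Sum>S\<in>through e. sign D e S * coef D S T)
      = (\<Sum>S\<in>{all_plus D {e, w}, all_plus D {e, u}}. sign D e S * coef D S T)"
  proof (rule sum.mono_neutral_right[OF finite_through])
    show "{all_plus D {e, w}, all_plus D {e, u}} \<subseteq> through e"
      using lt ew by (auto simp: through_iff)
    show "\<forall>S \<in> through e - {all_plus D {e, w}, all_plus D {e, u}}. sign D e S * coef D S T = 0"
    proof
      fix S assume S: "S \<in> through e - {all_plus D {e, w}, all_plus D {e, u}}"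
      then obtain a where a: "a < ncross D" "a \<noteq> e" "S = all_plus D {e, a}"
        by (auto simp: through_iff)
      with S have "a \<notin> {e, w, u}" by auto
      moreover have "a \<in> negs D (fst S)" using a e by (simp add: negs_state)
      moreover have "S \<in> gen 2" using S by (simp add: through_def)
      ultimately have "coef D S T = 0"
        using gen_nonzeroE[of S 2 T] T M by (metis eval_nat_numeral(3) insertCI)
      then show "sign D e S * coef D S T = 0" by simp
    qed
  qed
  also have "\<dots> = sign D e (all_plus D {e, w}) * coef D (all_plus D {e, w}) T
      + sign D e (all_plus D {e, u}) * coef D (all_plus D {e, u}) T"
    using ne by simp
  also have "\<dots> = 0"
    using wu by (auto simp: coef[of w u] coef[of u w] insert_commute power_add)
  finally show ?thesis .
qed

text \<open>Let \<open>w\<close> be the other negative marker of \<open>T\<close>. The source with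
  negative circle \<open>c\<close> contributes \<open>sign D e T\<close> if \<open>c\<close> touches
  \<open>w\<close>, and 0 otherwise. After the contraction of \<open>e\<close> the edge
  \<open>w\<close> is still no loop, so exactly two circles contribute, with equal signs.\<close>

lemma twice_torsion_chain_coef:
  assumes T: "T \<in> gen 2"
  shows "(\<Sum>S\<in>{S \<in> gen 1. negs D (fst S) = {e}}. coef D S T)
    = (if T \<in> through e then 2 * sign D e T else 0)"
proof (cases "T \<in> through e")
  case False
  then have "e \<notin> negs D (fst T)" using T by (simp add: through_def)
  then have "coef D S T = 0" if "S \<in> gen 1" "negs D (fst S) = {e}" for S
    using gen_nonzeroE[of S 1 T] that T by (metis insertCI One_nat_def Suc_1)
  with False show ?thesis by simp
next
  case True
  then obtain w where w: "w < ncross D" "w \<noteq> e" "T = all_plus D {e, w}"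
    by (auto simp: through_iff)
  have img: "{S \<in> gen 1. negs D (fst S) = {e}} = one_minus D e ` circ (state D {e})"
  proof (intro equalityI subsetI)
    fix S assume "S \<in> {S \<in> gen 1. negs D (fst S) = {e}}"
    then show "S \<in> one_minus D e ` circ (state D {e})"
      by (blast elim: gen_1_eq_one_minus)
  qed (use one_minus_in_gen[OF e] e in \<open>auto simp: negs_state\<close>)
  have inj: "inj_on (one_minus D e) (circ (state D {e}))"
    by (rule inj_onI) (metis minus_circles_one_minus singleton_inject)
  have sign: "sign D e T = (if w < e then -1 else 1)"
  proof -
    have "sign D e T = (-1) ^ card {z \<in> {e, w}. z < e}"
      using w e by (simp add: sign_def negs_state)
    then show ?thesis by (simp only: card_pair_filter[OF not_sym[OF w(2)]]) simp
  qed
  have "(\<Sum>S\<in>{S \<in> gen 1. negs D (fst S) = {e}}. coef D S T)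
      = (\<Sum>c\<in>circ (state D {e}). coef D (one_minus D e c) T)"
    unfolding img by (simp add: sum.reindex[OF inj])
  also have "\<dots> = (\<Sum>c\<in>circ (state D {e}). sign D e T * of_bool (touches c w))"
    using coef_one_minus[OF e w(1) singular[OF w(1,2)]] by (intro sum.cong) (simp_all add: w(3) sign[unfolded w(3)])
  also have "\<dots> = sign D e T * int (card {c \<in> circ (state D {e}). touches c w})"
    by (simp only: sum_distrib_left[symmetric] sum_of_bool_eq finite_circles Int_def mem_Collect_eq
        finite_Collect_conjI simp_thms)
  finally show ?thesis
    using True card_touching_one_marker[OF e w(1) singular[OF w(1,2)]] by simp
qed

end

end

section \<open>Parity of coefficient sums over the pairs of edges in a cycle\<close>

context loopless_diagram
begin

text \<open>An element of the cycle space modulo 2 without parallel edges. The parity argument uses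
  a cycle in this form, in which no order of its edges has to be followed through a
  contraction.\<close>

definition even_simple_edges :: "nat set \<Rightarrow> bool" where
  "even_simple_edges C \<longleftrightarrow> C \<subseteq> {..<ncross D} \<and> inj_on ends_of C \<and>
     (\<forall>A \<in> circ (state D {}). even (card {v \<in> C. touches A v}))"

text \<open>Circles away from \<open>v\<close> keep their edges. If \<open>A\<close> and
  \<open>B\<close> are the ends of \<open>v\<close>, the degree of the merged circle in
  \<open>C - {v}\<close> is the sum of the degrees of \<open>A\<close> and \<open>B\<close> in
  \<open>C\<close> minus 2, because \<open>v\<close> is the only edge of \<open>C\<close> joining
  \<open>A\<close> and \<open>B\<close>.\<close>

lemma even_simple_edges_one_marker:
  assumes C: "even_simple_edges C" and v: "v \<in> C" and c: "c \<in> circ (state D {v})"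
  shows "even (card {w \<in> C - {v}. touches c w})"
proof -
  have vN: "v < ncross D" and finC: "finite C" using C v finite_subset by (auto simp: even_simple_edges_def)
  have ev: "even (card {w \<in> C. touches A w})" if "A \<in> circ (state D {})" for A
    using C that by (simp add: even_simple_edges_def)
  show ?thesis
  proof (cases "touches c v")
    case False
    then have "c \<in> circ (state D {})" using c circles_one_marker(3)[OF vN] by blast
    moreover have "{w \<in> C - {v}. touches c w} = {w \<in> C. touches c w}" using False by auto
    ultimately show ?thesis using ev by simp
  next
    case True
    then have "c \<in> {c \<in> circ (state D {v}). touches c v}" using c by simp
    then have c_eq: "c = \<Union> (ends_of v)" unfolding circles_one_marker(1)[OF vN] by simp
    obtain A B where AB: "ends_of v = {A, B}" "A \<noteq> B"
      using loopless[OF vN] by (auto simp: card_2_iff)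
    let ?t = "\<lambda>X. {w \<in> C. touches X w}"
    have "touches c w \<longleftrightarrow> touches A w \<or> touches B w" for w
      unfolding c_eq AB by (auto simp: touches_def)
    then have eq: "{w \<in> C - {v}. touches c w} = ?t A \<union> ?t B - {v}" by auto
    have AB0: "A \<in> circ (state D {})" "B \<in> circ (state D {})" "touches A v" "touches B v"
      using AB by (auto simp: ends_of_def)
    have "?t A \<inter> ?t B = {v}"
    proof (intro equalityI subsetI)
      fix w assume w: "w \<in> ?t A \<inter> ?t B"
      then have "w < ncross D" using C by (auto simp: even_simple_edges_def)
      have "{A, B} \<subseteq> ends_of w" using w AB0 by (auto simp: ends_of_def)
      moreover have "finite (ends_of w)" using finite_circles by (simp add: ends_of_def)
      ultimately have "ends_of w = ends_of v"
        using card_subset_eq[of "ends_of w" "{A, B}"] loopless[OF \<open>w < _\<close>] AB by simp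
      with C v w show "w \<in> {v}" by (auto simp: even_simple_edges_def inj_on_def)
    qed (use v AB0 in auto)
    then have "card (?t A) + card (?t B) = card (?t A \<union> ?t B) + 1"
      using card_Un_Int[of "?t A" "?t B"] finC by simp
    moreover have "card (?t A \<union> ?t B) = Suc (card (?t A \<union> ?t B - {v}))"
      by (rule card.remove) (use finC v AB0 in auto)
    ultimately show ?thesis
      using ev[OF AB0(1)] ev[OF AB0(2)] unfolding eq by presburger
  qed
qed

definition states_in :: "nat set \<Rightarrow> enhanced_state set" where
  "states_in C = {T \<in> gen 2. negs D (fst T) \<subseteq> C}"

lemma finite_states_in: "finite (states_in C)"
  using finite_gen by (simp add: states_in_def)

text \<open>A nonzero coefficient requires a target that keeps the negative marker \<open>v\<close>
  of \<open>S\<close>; if \<open>v\<close> is not in \<open>C\<close>, \<open>states_in C\<close>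
  has none. Otherwise each \<open>w\<close> in \<open>C - {v}\<close> gives one target, whose
  coefficient is odd exactly if the negative circle of \<open>S\<close> touches \<open>w\<close>,
  and the number of these \<open>w\<close> is even.\<close>

lemma even_coef_states_in:
  assumes C: "even_simple_edges C" and S: "S \<in> gen 1"
  shows "even (\<Sum>T\<in>states_in C. coef D S T)"
proof -
  have CN: "C \<subseteq> {..<ncross D}" using C by (simp add: even_simple_edges_def)
  have "card (negs D (fst S)) = 1" using S by (simp add: gen_iff)
  then obtain v where v: "negs D (fst S) = {v}" by (auto simp: card_1_singleton_iff)
  then have vN: "v < ncross D" using negs_subset[of D "fst S"] by auto
  from S v obtain c where c: "c \<in> circ (state D {v})" "S = one_minus D v c"
    by (rule gen_1_eq_one_minus)
  have nonzero: "\<exists>w. negs D (fst T) = {v, w} \<and> w \<noteq> v" if "T \<in> gen 2" "coef D S T \<noteq> 0" for T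
    using gen_nonzeroE[OF S, of T] that v by (metis Suc_1 insert_commute singletonI)
  show ?thesis
  proof (cases "v \<in> C")
    case False
    have "coef D S T = 0" if "T \<in> states_in C" for T
      using nonzero[of T] that False by (auto simp: states_in_def)
    then show ?thesis by simp
  next
    case True
    have ne: "ends_of v \<noteq> ends_of w" if "w \<in> C - {v}" for w
      using C True that by (auto simp: even_simple_edges_def inj_on_def)
    have inj: "inj_on (\<lambda>w. all_plus D {v, w}) (C - {v})"
    proof (rule inj_onI)
      fix w u assume wu: "w \<in> C - {v}" "u \<in> C - {v}" "all_plus D {v, w} = all_plus D {v, u}"
      then have "negs D (state D {v, w}) = negs D (state D {v, u})" by (metis fst_all_plus)
      moreover have "{v, w} \<subseteq> {..<ncross D}" "{v, u} \<subseteq> {..<ncross D}" using wu vN CN by auto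
      ultimately have "{v, w} = {v, u}" by (simp only: negs_state)
      with wu show "w = u" by (auto simp: doubleton_eq_iff)
    qed
    have "(\<Sum>T\<in>states_in C. coef D S T) = (\<Sum>T\<in>(\<lambda>w. all_plus D {v, w}) ` (C - {v}). coef D S T)"
    proof (rule sum.mono_neutral_right[OF finite_states_in])
      show "(\<lambda>w. all_plus D {v, w}) ` (C - {v}) \<subseteq> states_in C"
        using all_plus_in_gen[OF vN _ ne] CN vN True by (auto simp: states_in_def negs_state)
      show "\<forall>T \<in> states_in C - (\<lambda>w. all_plus D {v, w}) ` (C - {v}). coef D S T = 0"
      proof (intro ballI, rule ccontr)
        fix T assume T: "T \<in> states_in C - (\<lambda>w. all_plus D {v, w}) ` (C - {v})" and "coef D S T \<noteq> 0"
        then obtain w where w: "negs D (fst T) = {v, w}" "w \<noteq> v"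
          using nonzero[of T] by (auto simp: states_in_def)
        then have "w \<in> C - {v}" "T \<in> gen 2" using T by (auto simp: states_in_def)
        with w ne gen_2_eq_all_plus[of T v w] T show False by blast
      qed
    qed
    also have "\<dots> = (\<Sum>w\<in>C - {v}. coef D S (all_plus D {v, w}))"
      by (simp add: sum.reindex[OF inj])
    also have "\<dots> = (\<Sum>w\<in>C - {v}. (if w < v then -1 else 1) * of_bool (touches c w))"
      using coef_one_minus[OF vN _ ne c(1)] CN by (intro sum.cong) (auto simp: c(2))
    also have "even \<dots> \<longleftrightarrow> even (card {w \<in> C - {v}. touches c w})"
    proof -
      have "finite (C - {v})" using CN finite_subset by blast
      moreover have "{w \<in> C - {v}. odd ((if w < v then -1 else 1) * of_bool (touches c w) :: int)}
          = {w \<in> C - {v}. touches c w}" by auto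
      ultimately show ?thesis by (simp only: even_sum_iff)
    qed
    finally show ?thesis using even_simple_edges_one_marker[OF C True c(1)] by simp
  qed
qed

lemma khovanov_Z2_torsion:
  assumes C: "even_simple_edges C" and e: "e \<in> C" and even: "even (card C)"
    and singular: "\<And>f. f < ncross D \<Longrightarrow> f \<noteq> e \<Longrightarrow> ends_of e \<noteq> ends_of f"
  shows "has_Z2_torsion (khovanov_homology D (int (ncross D) - 4)
    (int (ncross D) + 2 * int (card (circ (state D {}))) - 8))"
proof -
  let ?i = "int (ncross D) - 4"
  let ?j = "int (ncross D) + 2 * int (card (circ (state D {}))) - 8"
  let ?x = "torsion_chain e"
  have CN: "C \<subseteq> {..<ncross D}" using C by (simp add: even_simple_edges_def)
  then have eN: "e < ncross D" using e by auto
  have gens: "generators D (?i + 2) ?j = gen 1" "generators D ?i ?j = gen 2"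
    "generators D (?i - 2) ?j = gen 3"
    by (simp_all add: gen_def)
  have d1: "Poly_Mapping.lookup (differential D (?i + 2) ?j z) T =
      (if T \<in> gen 2 then \<Sum>S\<in>A. Poly_Mapping.lookup z S * coef D S T else 0)"
    if "Poly_Mapping.keys z \<subseteq> A" "finite A" for z T A
    using lookup_differential[of A z D "?i + 2" ?j T] that finite_gen gens by simp
  have lookup_x: "Poly_Mapping.lookup ?x T = (if T \<in> through e then sign D e T else 0)" for T
    unfolding torsion_chain_def by (rule lookup_frag_combination) (rule finite_through)
  have keys_x: "Poly_Mapping.keys ?x \<subseteq> through e"
    unfolding torsion_chain_def by (rule keys_frag_combination)
  show ?thesis
  proof (rule khovanov_homology_has_Z2_torsion[where x = ?x])
    show "Poly_Mapping.keys ?x \<subseteq> generators D ?i ?j"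
      using keys_x by (auto simp: gens through_def)
    show "differential D ?i ?j ?x = 0"
    proof (rule poly_mapping_eqI)
      fix T
      have "Poly_Mapping.lookup (differential D ?i ?j ?x) T =
          (if T \<in> gen 3 then \<Sum>S\<in>through e. Poly_Mapping.lookup ?x S * coef D S T else 0)"
        using lookup_differential[OF finite_through keys_x, of D ?i ?j T] finite_gen gens by simp
      then show "Poly_Mapping.lookup (differential D ?i ?j ?x) T = Poly_Mapping.lookup 0 T"
        using torsion_chain_cycle_coef[OF eN singular, of T] by (simp add: lookup_x)
    qed
    define Y where "Y = {S \<in> gen 1. negs D (fst S) = {e}}"
    have finY: "finite Y" using finite_gen by (simp add: Y_def)
    \<comment> \<open>The scalar 1 gives the sum the shape that \<open>keys_frag_combination\<close>
      and \<open>lookup_frag_combination\<close> expect.\<close>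
    define y where "y = (\<Sum>S\<in>Y. frag_cmul 1 (frag_of S))"
    have keys_y: "Poly_Mapping.keys y \<subseteq> Y" unfolding y_def by (rule keys_frag_combination)
    have lookup_y: "Poly_Mapping.lookup y S = (if S \<in> Y then 1 else 0)" for S
      unfolding y_def by (rule lookup_frag_combination[OF finY])
    have "differential D (?i + 2) ?j y = ?x + ?x"
    proof (rule poly_mapping_eqI)
      fix T
      have "Poly_Mapping.lookup (differential D (?i + 2) ?j y) T =
          (if T \<in> gen 2 then \<Sum>S\<in>Y. coef D S T else 0)"
        unfolding d1[OF keys_y finY] by (simp add: lookup_y)
      then show "Poly_Mapping.lookup (differential D (?i + 2) ?j y) T = Poly_Mapping.lookup (?x + ?x) T"
        using twice_torsion_chain_coef[OF eN singular, of T]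
        by (auto simp: lookup_add lookup_x Y_def through_def)
    qed
    moreover have "y \<in> carrier (chain_group D (?i + 2) ?j)"
      using keys_y unfolding chain_group_def gens by (auto simp: Y_def)
    ultimately show "?x + ?x \<in> boundaries D ?i ?j" unfolding boundaries_def by (metis image_eqI)
    show "?x \<notin> boundaries D ?i ?j"
    proof
      assume "?x \<in> boundaries D ?i ?j"
      then obtain z where z: "?x = differential D (?i + 2) ?j z" "Poly_Mapping.keys z \<subseteq> gen 1"
        unfolding boundaries_def chain_group_def gens by auto
      \<comment> \<open>Summing the coefficients over \<open>states_in C\<close> is linear, so on a
        boundary it reduces to the single generators treated in
        \<open>even_coef_states_in\<close>.\<close>
      have "(\<Sum>T\<in>states_in C. Poly_Mapping.lookup ?x T)
          = (\<Sum>T\<in>states_in C. \<Sum>S\<in>gen 1. Poly_Mapping.lookup z S * coef D S T)"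
        unfolding z(1) d1[OF z(2) finite_gen] by (intro sum.cong) (auto simp: states_in_def)
      also have "\<dots> = (\<Sum>S\<in>gen 1. Poly_Mapping.lookup z S * (\<Sum>T\<in>states_in C. coef D S T))"
        by (subst sum.swap) (simp add: sum_distrib_left)
      also have "even \<dots>" by (rule dvd_sum, rule dvd_mult, rule even_coef_states_in[OF C])
      finally have "even (\<Sum>T\<in>states_in C. Poly_Mapping.lookup ?x T)" .
      moreover have "even (\<Sum>T\<in>states_in C. Poly_Mapping.lookup ?x T)
          \<longleftrightarrow> even (card {T \<in> states_in C. T \<in> through e})"
      proof -
        have "odd (Poly_Mapping.lookup ?x T) \<longleftrightarrow> T \<in> through e" for T
          by (simp add: lookup_x sign_def)
        then show ?thesis by (simp add: even_sum_iff[OF finite_states_in])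
      qed
      \<comment> \<open>The chain has a coefficient 1 or -1 for each edge of \<open>C\<close> other
        than \<open>e\<close>; their number is odd because \<open>card C\<close> is even.\<close>
      moreover have "card {T \<in> states_in C. T \<in> through e} = card (C - {e})"
      proof (rule bij_betw_same_card[symmetric])
        have neg: "negs D (state D {e, w}) = {e, w}" if "w \<in> C" for w
          using that eN CN by (intro negs_state) auto
        show "bij_betw (\<lambda>w. all_plus D {e, w}) (C - {e}) {T \<in> states_in C. T \<in> through e}"
          unfolding bij_betw_def
        proof
          show "inj_on (\<lambda>w. all_plus D {e, w}) (C - {e})"
          proof (rule inj_onI)
            fix w u assume wu: "w \<in> C - {e}" "u \<in> C - {e}" "all_plus D {e, w} = all_plus D {e, u}"
            then have "{e, w} = {e, u}" using neg by (metis DiffD1 fst_all_plus)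
            with wu show "w = u" by (auto simp: doubleton_eq_iff)
          qed
          show "(\<lambda>w. all_plus D {e, w}) ` (C - {e}) = {T \<in> states_in C. T \<in> through e}"
          proof (intro equalityI subsetI)
            fix T assume "T \<in> (\<lambda>w. all_plus D {e, w}) ` (C - {e})"
            then obtain w where w: "w \<in> C" "w \<noteq> e" "T = all_plus D {e, w}" by auto
            then have "T \<in> through e" using through_iff[OF eN singular] CN by blast
            with w e show "T \<in> {T \<in> states_in C. T \<in> through e}"
              by (auto simp: states_in_def through_def neg)
          next
            fix T assume T: "T \<in> {T \<in> states_in C. T \<in> through e}"
            then obtain w where w: "w < ncross D" "w \<noteq> e" "T = all_plus D {e, w}"
              using through_iff[OF eN singular] by blast
            moreover have "w \<in> negs D (fst T)" using w eN by (simp add: negs_state)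
            ultimately show "T \<in> (\<lambda>w. all_plus D {e, w}) ` (C - {e})"
              using T by (auto simp: states_in_def)
          qed
        qed
      qed
      moreover have "card C = Suc (card (C - {e}))"
        using e CN finite_subset by (intro card.remove) blast+
      ultimately show False using even by simp
    qed
  qed
qed

end

section \<open>Cycles given as lists, and the conclusion for diagrams\<close>

text \<open>The cyclic successor permutes the indices, so \<open>A\<close> occurs equally often as
  first and as second end of an edge. No edge counts for both, since for \<open>n \<ge> 2\<close> no
  index is its own successor.\<close>

lemma even_card_cycle_incidence:
  assumes "distinct xs" "length xs = n" "n \<ge> 2"
  shows "even (card {k. k < n \<and> (xs ! k = A \<or> xs ! (Suc k mod n) = A)})"
proof -
  let ?f = "\<lambda>k. Suc k mod n"
  let ?S = "{k. k < n \<and> xs ! k = A}" and ?T = "{k. k < n \<and> xs ! (Suc k mod n) = A}"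
  have f: "?f k = (if Suc k = n then 0 else Suc k)" if "k < n" for k
    using that by (simp add: mod_Suc)
  have inj: "inj_on ?f {..<n}" by (rule inj_onI) (auto simp: f split: if_splits)
  have lt: "?f k < n" for k using assms(3) by simp
  have surj: "?f ` {..<n} = {..<n}"
    by (rule endo_inj_surj[OF finite_lessThan _ inj]) (auto simp: lt)
  have img: "?f ` ?T = ?S"
  proof (intro equalityI subsetI)
    fix k assume k: "k \<in> ?S"
    then obtain l where "l < n" "k = ?f l" using surj by blast
    with k show "k \<in> ?f ` ?T" by blast
  qed (use lt in auto)
  have "card ?T = card ?S"
    unfolding img[symmetric] by (rule card_image[symmetric], rule inj_on_subset[OF inj]) auto
  moreover have "?S \<inter> ?T = {}"
  proof -
    have "xs ! k \<noteq> xs ! ?f k" if "k < n" for k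
      using that assms by (auto simp: f nth_eq_iff_index_eq)
    then show ?thesis by fastforce
  qed
  moreover have "{k. k < n \<and> (xs ! k = A \<or> xs ! (Suc k mod n) = A)} = ?S \<union> ?T" by auto
  ultimately show ?thesis by (simp add: card_Un_disjoint)
qed

text \<open>Two different edges with the same ends would be traversed in opposite directions. Then
  \<open>k\<close> and \<open>l\<close> are cyclic successors of each other, which forces a length
  of at most 2.\<close>

lemma cycle_no_parallel:
  assumes "distinct xs" "length xs = n" "n \<ge> 3" "k < n" "l < n"
    and eq: "{xs ! k, xs ! (Suc k mod n)} = {xs ! l, xs ! (Suc l mod n)}"
  shows "k = l"
proof (rule ccontr)
  assume "k \<noteq> l"
  have f: "Suc k mod n = (if Suc k = n then 0 else Suc k)" if "k < n" for k
    using that by (simp add: mod_Suc)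
  have "xs ! k \<noteq> xs ! l" using \<open>k \<noteq> l\<close> assms by (simp add: nth_eq_iff_index_eq)
  then have "xs ! k = xs ! (Suc l mod n)" "xs ! (Suc k mod n) = xs ! l"
    using eq by (auto simp: doubleton_eq_iff)
  then have "k = Suc l mod n" "Suc k mod n = l"
    using assms by (simp_all add: nth_eq_iff_index_eq)
  with assms(3-5) show False by (auto simp: f split: if_splits)
qed

theorem theoremX3p2:
  fixes D :: link_diagram and N n :: nat
    and xs :: "(nat \<times> nat) set list" and es :: "nat list" and e :: nat
  assumes "is_link_diagram D"
    and "connected_diagram D"
    and "ncross D = N"
    and "\<forall>v. \<not> is_loop (state_graph D (s_plus D)) v"
    and "even n"
    and "is_cycle (state_graph D (s_plus D)) n xs es"
    and "e \<in> set es"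
    and "singular_edge (state_graph D (s_plus D)) e"
  shows "has_Z2_torsion
    (khovanov_homology D (int N - 4) (int N + 2 * int (card (circles D (s_plus D))) - 8))"
proof -
  interpret pd_code D
    using assms(1) by unfold_locales (auto simp: is_link_diagram_def)
  have ends: "ends (state_graph D (s_plus D)) = ends_of"
    by (auto simp: state_graph_def ends_of_def s_plus_eq_state)
  have graph: "edges (state_graph D (s_plus D)) = {..<ncross D}"
    "vertices (state_graph D (s_plus D)) = circ (state D {})"
    by (simp_all add: state_graph_def s_plus_eq_state)
  interpret loopless_diagram D
  proof
    fix v assume v: "v < ncross D"
    \<comment> \<open>One or two circles meet at a crossing, and a single one would make the edge a
      loop.\<close>
    then have "card (ends_of v) \<noteq> 1"
      using assms(4) by (auto simp: is_loop_def ends graph card_1_singleton_iff)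
    then show "card (ends_of v) = 2"
      using touching_circles_card[OF v] by (auto simp: ends_of_def)
  qed
  have len: "length xs = n" "length es = n" and dist: "distinct xs" "distinct es" and "n \<ge> 1"
    and sub: "set es \<subseteq> {..<ncross D}"
    and ends_es: "\<And>k. k < n \<Longrightarrow> ends_of (es ! k) = {xs ! k, xs ! (Suc k mod n)}"
    using assms(6) by (auto simp: is_cycle_def ends graph)
  have e: "e < ncross D" using assms(7) sub by auto
  have singular: "ends_of e \<noteq> ends_of f" if "f < ncross D" "f \<noteq> e" for f
    using assms(8) that by (auto simp: singular_edge_def ends graph)
  \<comment> \<open>A cycle of length 2 would be a 2-gon through the singular edge \<open>e\<close>.
    Length 1 is excluded by parity.\<close>
  have "n \<noteq> 2"
  proof
    assume n: "n = 2"
    have "ends_of (es ! 0) = ends_of (es ! 1)" using ends_es[of 0] ends_es[of 1] n by auto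
    moreover have "es ! 0 \<noteq> es ! 1" using dist(2) len n by (simp add: nth_eq_iff_index_eq)
    moreover have "e = es ! 0 \<or> e = es ! 1"
      using assms(7) len n by (auto simp: in_set_conv_nth less_2_cases_iff)
    moreover have "es ! 0 < ncross D" "es ! 1 < ncross D"
      using subsetD[OF sub nth_mem[of 0 es]] subsetD[OF sub nth_mem[of 1 es]] len n by simp_all
    ultimately show False using singular by metis
  qed
  with \<open>even n\<close> \<open>n \<ge> 1\<close> have n: "n \<ge> 3" by presburger
  have "even_simple_edges (set es)"
    unfolding even_simple_edges_def
  proof (intro conjI ballI sub)
    show "inj_on ends_of (set es)"
    proof (rule inj_onI)
      fix v w assume "v \<in> set es" "w \<in> set es" and eq: "ends_of v = ends_of w"
      then obtain k l where "k < n" "l < n" "v = es ! k" "w = es ! l"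
        using len by (metis in_set_conv_nth)
      with cycle_no_parallel[OF dist(1) len(1) n, of k l] ends_es eq show "v = w" by simp
    qed
    fix A assume A: "A \<in> circ (state D {})"
    have "touches A (es ! k) \<longleftrightarrow> xs ! k = A \<or> xs ! (Suc k mod n) = A" if "k < n" for k
    proof -
      have "touches A (es ! k) \<longleftrightarrow> A \<in> ends_of (es ! k)" using A by (simp add: ends_of_def)
      then show ?thesis unfolding ends_es[OF that] by auto
    qed
    then have "{v \<in> set es. touches A v} =
        (!) es ` {k. k < n \<and> (xs ! k = A \<or> xs ! (Suc k mod n) = A)}"
      using len by (auto simp: in_set_conv_nth)
    moreover have "inj_on ((!) es) {k. k < n \<and> (xs ! k = A \<or> xs ! (Suc k mod n) = A)}"
      by (rule inj_on_nth[OF dist(2)]) (simp add: len)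
    ultimately show "even (card {v \<in> set es. touches A v})"
      using even_card_cycle_incidence[OF dist(1) len(1)] n by (simp add: card_image)
  qed
  moreover have "even (card (set es))" using \<open>even n\<close> dist len by (simp add: distinct_card)
  ultimately show ?thesis
    using khovanov_Z2_torsion[OF _ assms(7) _ singular] assms(3) by (simp add: s_plus_eq_state)
qed

end
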